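(* Let $M$ be a loopless matroid on a finite totally ordered ground set $E$, with lattice of flats $\mathcal{L}$, let $B$ be a building set of $\mathcal{L}$, and let $\Delta(\mathcal{L},B)$ be the associated nested set complex. Let $\varphi$ be a cubical piecewise linear function on the Bergman fan $\Sigma_{\mathcal{L},B}$, so that $\varphi$ determines a normal complex of $\Sigma_{\mathcal{L},B}$ whose vertices indexed by the inclusion-maximal nested sets $N$ are the points $v_N\in\mathbb{R}^E$. Order the inclusion-maximal nested sets lexicographically by the coordinates of these vertices, with larger coordinates first: $N$ precedes $N'$ if and only if there is an index $k\in E$ with $(v_N)_k>(v_{N'})_k$ and $(v_N)_i=(v_{N'})_i$ for all $i\in E$ with $i<k$. Then this order (transported to the facets $N\setminus\max(B)$ of $\Delta(\mathcal{L},B)$) is a shelling order of $\Delta(\mathcal{L},B)$.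
   Context: Flats are ordered by inclusion, $\vee$ is the join in $\mathcal{L}$; parallel elements are allowed, and since $M$ is loopless the bottom flat is $\emptyset$. A building set is a subset $B\subseteq\mathcal{L}\setminus\{\emptyset\}$ such that for every $X\in\mathcal{L}\setminus\{\emptyset\}$ the map $\prod_{Y\in\max(B_{\le X})}[\emptyset,Y]\to[\emptyset,X]$ sending a tuple to its join is a poset isomorphism, where $\max(B_{\le X})$ is the set of inclusion-maximal elements of $B$ that are $\le X$. Write $\max(B)$ for the set of inclusion-maximal elements of $B$. A subset $N\subseteq B$ is nested if $\max(B)\subseteq N$ and for any $\ell\ge 2$ pairwise incomparable flats $X_1,\dots,X_\ell\in N$ one has $\bigvee_{i=1}^{\ell}X_i\notin B$. The nested set complex is the simplicial complex $\Delta(\mathcal{L},B)=\{N\setminus\max(B): N \text{ nested}\}$ (a pure complex); its facets are the sets $N\setminus\max(B)$ with $N$ an inclusion-maximal nested set. For $X\subseteq E$ let $e_X=\sum_{i\in X}e_i\in\mathbb{R}^E$, with the standard inner product on $\mathbb{R}^E$. The Bergman fan $\Sigma_{\mathcal{L},B}$ is the fan in $\mathbb{R}^E$ with lineality space $L_B=\mathrm{span}_{\mathbb{R}}\{e_X: X\in\max(B)\}$ and cones $\sigma_N=L_B+\mathrm{cone}(e_X: X\in N\setminus\max(B))$ for each nested set $N$. A piecewise linear function $\varphi$ is a function on the support that is linear on each cone; write $\varphi_X=\varphi(e_X)$ for $X\in B$. Such functions correspond bijectively to vectors $(\varphi_X)_{X\in B}\in\mathbb{R}^B$. Let $H_{X,\varphi}=\{v\in\mathbb{R}^E:\langle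 v,e_X\rangle=\varphi_X\}$. The function $\varphi$ is cubical if for every nested set $N$ the intersection $\sigma_N^\circ\cap\bigcap_{X\in N}H_{X,\varphi}$ is a single point, denoted $v_N$, where $\sigma_N^\circ$ is the relative interior of $\sigma_N$. A normal complex is the polytopal complex determined by a cubical $\varphi$; only its vertices $v_N$ are used here. A linear order $\prec$ on the facets of a pure simplicial complex is a shelling order if for all facets $F'\prec F$ there exist a facet $F''\prec F$ and $X\in F$ with $F\cap F'\subseteq F\cap F''=F\setminus\{X\}$. *)

theory Defs
  imports "HOL-Analysis.Analysis"
begin

section \<open>Matroids and their flats\<close>

locale matroid =
  fixes E :: "'e set" and indep :: "'e set \<Rightarrow> bool"
  assumes finite_ground: "finite E"
    and indep_subset_ground: "indep I \<Longrightarrow> I \<subseteq> E"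
    and indep_empty: "indep {}"
    and indep_mono: "indep I \<Longrightarrow> J \<subseteq> I \<Longrightarrow> indep J"
    and indep_augment:
      "indep I \<Longrightarrow> indep J \<Longrightarrow> card I < card J \<Longrightarrow> \<exists>x\<in>J - I. indep (insert x I)"

definition loopless :: "'e set \<Rightarrow> ('e set \<Rightarrow> bool) \<Rightarrow> bool" where
  "loopless E indep \<longleftrightarrow> (\<forall>x\<in>E. indep {x})"

definition rank_of :: "('e set \<Rightarrow> bool) \<Rightarrow> 'e set \<Rightarrow> nat" where
  "rank_of indep X = Max (card ` {I. indep I \<and> I \<subseteq> X})"

definition closure_of_set :: "'e set \<Rightarrow> ('e set \<Rightarrow> bool) \<Rightarrow> 'e set \<Rightarrow> 'e set" where
  "closure_of_set E indep X = {x \<in> E. rank_of indep (insert x X) = rank_of indep X}"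

definition flats :: "'e set \<Rightarrow> ('e set \<Rightarrow> bool) \<Rightarrow> 'e set set" where
  "flats E indep = {F. F \<subseteq> E \<and> closure_of_set E indep F = F}"

text \<open>The join of a family of flats is the smallest flat containing all of them; for the
  flats of a matroid this is the least upper bound, see \<open>join_flats_is_lub\<close> below.\<close>

definition join :: "'e set set \<Rightarrow> 'e set set \<Rightarrow> 'e set" where
  "join L S = \<Inter>{F \<in> L. \<Union>S \<subseteq> F}"


section \<open>Building sets and nested sets\<close>

definition maximal_elems :: "'a set set \<Rightarrow> 'a set set" where
  "maximal_elems S = {X \<in> S. \<not> (\<exists>Y\<in>S. X \<subset> Y)}"

text \<open>Since the flats considered are those of a loopless matroid, the interval from the bottom
  flat to \<open>X\<close> consists of all flats contained in \<open>X\<close>.\<close>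

definition below :: "'e set set \<Rightarrow> 'e set \<Rightarrow> 'e set set" where
  "below L X = {Z \<in> L. Z \<subseteq> X}"

definition building_set :: "'e set set \<Rightarrow> 'e set set \<Rightarrow> bool" where
  "building_set L B \<longleftrightarrow> B \<subseteq> L - {{}} \<and>
     (\<forall>X \<in> L - {{}}.
        let I = maximal_elems {Y \<in> B. Y \<subseteq> X};
            P = (\<Pi>\<^sub>E Y\<in>I. below L Y)
        in bij_betw (\<lambda>z. join L (z ` I)) P (below L X) \<and>
           (\<forall>z\<in>P. \<forall>w\<in>P.
              (\<forall>Y\<in>I. z Y \<subseteq> w Y) \<longleftrightarrow> join L (z ` I) \<subseteq> join L (w ` I)))"

definition nested_set :: "'e set set \<Rightarrow> 'e set set \<Rightarrow> 'e set set \<Rightarrow> bool" where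
  "nested_set L B N \<longleftrightarrow> N \<subseteq> B \<and> maximal_elems B \<subseteq> N \<and>
     (\<forall>S \<subseteq> N. card S \<ge> 2 \<and> pairwise (\<lambda>X Y. \<not> X \<subseteq> Y \<and> \<not> Y \<subseteq> X) S \<longrightarrow> join L S \<notin> B)"

definition maximal_nested_sets :: "'e set set \<Rightarrow> 'e set set \<Rightarrow> 'e set set set" where
  "maximal_nested_sets L B = maximal_elems {N. nested_set L B N}"

definition nested_set_complex :: "'e set set \<Rightarrow> 'e set set \<Rightarrow> 'e set set set" where
  "nested_set_complex L B = {N - maximal_elems B | N. nested_set L B N}"


section \<open>Shellings\<close>

definition simplicial_complex :: "'v set set \<Rightarrow> bool" where
  "simplicial_complex \<Delta> \<longleftrightarrow> (\<forall>F\<in>\<Delta>. finite F \<and> (\<forall>G\<subseteq>F. G \<in> \<Delta>))"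

abbreviation facets :: "'v set set \<Rightarrow> 'v set set" where
  "facets \<Delta> \<equiv> maximal_elems \<Delta>"

definition pure_complex :: "'v set set \<Rightarrow> bool" where
  "pure_complex \<Delta> \<longleftrightarrow> simplicial_complex \<Delta> \<and> (\<forall>F\<in>facets \<Delta>. \<forall>G\<in>facets \<Delta>. card F = card G)"

text \<open>A pair \<open>(F', F) \<in> r\<close> means that \<open>F'\<close> strictly precedes \<open>F\<close>.\<close>

definition shelling_order :: "'v set set \<Rightarrow> 'v set rel \<Rightarrow> bool" where
  "shelling_order \<Delta> r \<longleftrightarrow>
     pure_complex \<Delta> \<and>
     r \<subseteq> facets \<Delta> \<times> facets \<Delta> \<and> strict_linear_order_on (facets \<Delta>) r \<and>
     (\<forall>F\<in>facets \<Delta>. \<forall>F'\<in>facets \<Delta>. (F', F) \<in> r \<longrightarrow>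
        (\<exists>F''\<in>facets \<Delta>. \<exists>X\<in>F.
           (F'', F) \<in> r \<and> F \<inter> F' \<subseteq> F \<inter> F'' \<and> F \<inter> F'' = F - {X}))"


section \<open>The Bergman fan and cubical functions\<close>

text \<open>The ground set \<open>E\<close> is a (possibly empty) subset of a finite linearly ordered type
  \<open>'e\<close>, and the space of real vectors indexed by \<open>E\<close> is the coordinate subspace of
  \<open>real ^ 'e\<close> of vectors supported on \<open>E\<close>.\<close>

definition coord_space :: "'e::finite set \<Rightarrow> (real ^ 'e) set" where
  "coord_space E = {v. \<forall>i. i \<notin> E \<longrightarrow> v $ i = 0}"

definition e_vec :: "'e::finite set \<Rightarrow> real ^ 'e" where
  "e_vec X = (\<Sum>i\<in>X. axis i 1)"

definition lineality_space :: "'e::finite set set \<Rightarrow> (real ^ 'e) set" where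
  "lineality_space B = span (e_vec ` maximal_elems B)"

definition nested_cone :: "'e::finite set set \<Rightarrow> 'e set set \<Rightarrow> (real ^ 'e) set" where
  "nested_cone B N = lineality_space B + convex_cone hull (e_vec ` (N - maximal_elems B))"

definition bergman_fan :: "'e::finite set set \<Rightarrow> 'e set set \<Rightarrow> (real ^ 'e) set set" where
  "bergman_fan L B = {nested_cone B N | N. nested_set L B N}"

text \<open>Only the values of \<open>\<phi>\<close> on the support of the fan are ever relevant.\<close>

definition piecewise_linear_on_fan ::
    "(real ^ 'e::finite) set set \<Rightarrow> (real ^ 'e \<Rightarrow> real) \<Rightarrow> bool" where
  "piecewise_linear_on_fan \<Sigma> \<phi> \<longleftrightarrow>
     (\<forall>\<sigma>\<in>\<Sigma>. \<exists>f. linear f \<and> (\<forall>v\<in>\<sigma>. \<phi> v = f v))"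

definition hyperplane_of ::
    "'e::finite set \<Rightarrow> (real ^ 'e \<Rightarrow> real) \<Rightarrow> 'e set \<Rightarrow> (real ^ 'e) set" where
  "hyperplane_of E \<phi> X = {v \<in> coord_space E. v \<bullet> e_vec X = \<phi> (e_vec X)}"

definition vertex_locus ::
    "'e::finite set \<Rightarrow> 'e set set \<Rightarrow> (real ^ 'e \<Rightarrow> real) \<Rightarrow> 'e set set \<Rightarrow> (real ^ 'e) set" where
  "vertex_locus E B \<phi> N = rel_interior (nested_cone B N) \<inter> (\<Inter>X\<in>N. hyperplane_of E \<phi> X)"

definition cubical ::
    "'e::finite set \<Rightarrow> 'e set set \<Rightarrow> 'e set set \<Rightarrow> (real ^ 'e \<Rightarrow> real) \<Rightarrow> bool" where
  "cubical E L B \<phi> \<longleftrightarrow>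
     piecewise_linear_on_fan (bergman_fan L B) \<phi> \<and>
     (\<forall>N. nested_set L B N \<longrightarrow> (\<exists>v. vertex_locus E B \<phi> N = {v}))"

definition vertex ::
    "'e::finite set \<Rightarrow> 'e set set \<Rightarrow> (real ^ 'e \<Rightarrow> real) \<Rightarrow> 'e set set \<Rightarrow> real ^ 'e" where
  "vertex E B \<phi> N = the_elem (vertex_locus E B \<phi> N)"


section \<open>The lexicographic order, larger coordinates first\<close>

definition lex_precedes ::
    "'e::{finite,linorder} set \<Rightarrow> (real, 'e) vec \<Rightarrow> (real, 'e) vec \<Rightarrow> bool" where
  "lex_precedes E v w \<longleftrightarrow>
     (\<exists>k\<in>E. v $ k > w $ k \<and> (\<forall>i\<in>E. i < k \<longrightarrow> v $ i = w $ i))"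

definition facet_lex_order ::
    "'e::{finite,linorder} set \<Rightarrow> 'e set set \<Rightarrow> 'e set set \<Rightarrow> ((real, 'e) vec \<Rightarrow> real)
      \<Rightarrow> 'e set set rel" where
  "facet_lex_order E L B \<phi> =
     {(N - maximal_elems B, N' - maximal_elems B) | N N'.
        N \<in> maximal_nested_sets L B \<and> N' \<in> maximal_nested_sets L B \<and>
        lex_precedes E (vertex E B \<phi> N) (vertex E B \<phi> N')}"


section \<open>Consistency of the definitions\<close>

lemma (in matroid) indep_finite: "indep I \<Longrightarrow> finite I"
  using finite_ground indep_subset_ground finite_subset by blast

lemma (in matroid) finite_indep_sets: "finite {I. indep I \<and> I \<subseteq> X}"
  by (rule finite_subset[of _ "Pow E"]) (use indep_subset_ground finite_ground in auto)

lemma (in matroid) card_le_rank: "indep I \<Longrightarrow> I \<subseteq> X \<Longrightarrow> card I \<le> rank_of indep X"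
  unfolding rank_of_def using finite_indep_sets by (intro Max_ge) auto

lemma (in matroid) rank_attained: "\<exists>I. indep I \<and> I \<subseteq> X \<and> card I = rank_of indep X"
proof -
  have "rank_of indep X \<in> card ` {I. indep I \<and> I \<subseteq> X}"
    unfolding rank_of_def using finite_indep_sets indep_empty by (intro Max_in) auto
  then show ?thesis by auto
qed

lemma (in matroid) extend_to_basis:
  assumes "indep I" "I \<subseteq> X"
  shows "\<exists>J. indep J \<and> I \<subseteq> J \<and> J \<subseteq> X \<and> card J = rank_of indep X"
  using assms
proof (induction "rank_of indep X - card I" arbitrary: I rule: less_induct)
  case less
  show ?case
  proof (cases "card I = rank_of indep X")
    case True
    with less.prems show ?thesis by blast
  next
    case False
    with card_le_rank[OF less.prems] have lt: "card I < rank_of indep X" by simp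
    obtain K where K: "indep K" "K \<subseteq> X" "card K = rank_of indep X"
      using rank_attained by blast
    obtain x where x: "x \<in> K - I" "indep (insert x I)"
      using indep_augment[OF less.prems(1) K(1)] lt K(3) by auto
    have "card (insert x I) = Suc (card I)"
      using x indep_finite[OF less.prems(1)] by simp
    then have "rank_of indep X - card (insert x I) < rank_of indep X - card I"
      using lt by simp
    moreover have "insert x I \<subseteq> X" using x(1) K(2) less.prems(2) by blast
    ultimately obtain J where
      "indep J \<and> insert x I \<subseteq> J \<and> J \<subseteq> X \<and> card J = rank_of indep X"
      using less.hyps[of "insert x I"] x(2) by blast
    then show ?thesis by blast
  qed
qed

lemma (in matroid) closure_mono:
  assumes "A \<subseteq> C" "x \<in> closure_of_set E indep A"
  shows "x \<in> closure_of_set E indep C"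
proof -
  obtain I where I: "indep I" "I \<subseteq> A" "card I = rank_of indep A"
    using rank_attained by blast
  obtain J where J: "indep J" "I \<subseteq> J" "J \<subseteq> C" "card J = rank_of indep C"
    using extend_to_basis[of I C] I assms(1) by blast
  obtain K where K: "indep K" "J \<subseteq> K" "K \<subseteq> insert x C" "card K = rank_of indep (insert x C)"
    using extend_to_basis[of J "insert x C"] J by blast
  have "rank_of indep (insert x C) = rank_of indep C"
  proof (rule ccontr)
    assume ne: "rank_of indep (insert x C) \<noteq> rank_of indep C"
    have "K \<noteq> J" using ne J K by auto
    have notC: "\<not> K \<subseteq> C"
    proof
      assume "K \<subseteq> C"
      then have "card K \<le> card J" using card_le_rank[of K C] K(1) J(4) by simp
      moreover have "J \<subset> K" using K(2) \<open>K \<noteq> J\<close> by blast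
      ultimately show False using psubset_card_mono[OF indep_finite[OF K(1)], of J] by simp
    qed
    then have xK: "x \<in> K" "x \<notin> C" using K(3) by auto
    then have "indep (insert x I)"
      using indep_mono[OF K(1), of "insert x I"] J(2) K(2) by auto
    moreover have "x \<notin> I" using xK I assms(1) by auto
    ultimately have "Suc (card I) \<le> rank_of indep (insert x A)"
      using card_le_rank[of "insert x I" "insert x A"] I indep_finite[OF I(1)] by auto
    then show False using assms(2) I(3) by (simp add: closure_of_set_def)
  qed
  then show ?thesis using assms(2) by (simp add: closure_of_set_def)
qed

lemma (in matroid) ground_flat: "E \<in> flats E indep"
  by (auto simp: flats_def closure_of_set_def insert_absorb)

lemma (in matroid) Inter_flats:
  assumes "\<F> \<subseteq> flats E indep" "\<F> \<noteq> {}"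
  shows "\<Inter>\<F> \<in> flats E indep"
proof -
  have sub: "\<Inter>\<F> \<subseteq> E" using assms by (auto simp: flats_def)
  have "closure_of_set E indep (\<Inter>\<F>) \<subseteq> F" if "F \<in> \<F>" for F
    using closure_mono[of "\<Inter>\<F>" F] that assms(1) by (auto simp: flats_def)
  moreover have "\<Inter>\<F> \<subseteq> closure_of_set E indep (\<Inter>\<F>)"
    using sub by (auto simp: closure_of_set_def insert_absorb)
  ultimately show ?thesis using sub by (auto simp: flats_def)
qed

lemma (in matroid) join_flats_is_lub:
  assumes "S \<subseteq> flats E indep"
  shows "join (flats E indep) S \<in> flats E indep"
    and "X \<in> S \<Longrightarrow> X \<subseteq> join (flats E indep) S"
    and "Z \<in> flats E indep \<Longrightarrow> (\<And>X. X \<in> S \<Longrightarrow> X \<subseteq> Z) \<Longrightarrow> join (flats E indep) S \<subseteq> Z"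
proof -
  have "\<Union>S \<subseteq> E" using assms by (auto simp: flats_def)
  then show "join (flats E indep) S \<in> flats E indep"
    unfolding join_def using ground_flat by (intro Inter_flats) auto
qed (auto simp: join_def)

lemma (in matroid) bottom_flat:
  assumes "loopless E indep"
  shows "{} \<in> flats E indep"
proof -
  have "rank_of indep {x} \<noteq> rank_of indep {}" if "x \<in> E" for x
  proof -
    have "rank_of indep {} = 0" using rank_attained[of "{}"] by auto
    moreover have "1 \<le> rank_of indep {x}"
      using card_le_rank[of "{x}" "{x}"] assms that by (auto simp: loopless_def)
    ultimately show ?thesis by simp
  qed
  then show ?thesis by (auto simp: flats_def closure_of_set_def)
qed

lemma facets_nested_set_complex:
  "facets (nested_set_complex L B) =
     (\<lambda>N. N - maximal_elems B) ` maximal_nested_sets L B"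
proof -
  define M where "M = maximal_elems B"
  have max: "M \<subseteq> N" if "nested_set L B N" for N
    using that by (simp add: nested_set_def M_def)
  have iff: "N - M \<subset> N' - M \<longleftrightarrow> N \<subset> N'"
    if "nested_set L B N" "nested_set L B N'" for N N'
    using max[OF that(1)] max[OF that(2)] by auto
  have mem: "X \<in> maximal_elems S \<longleftrightarrow> X \<in> S \<and> (\<forall>Y\<in>S. \<not> X \<subset> Y)"
    for X and S :: "'a set set set"
    by (simp add: maximal_elems_def)
  have face: "F \<in> nested_set_complex L B \<longleftrightarrow> (\<exists>N. F = N - M \<and> nested_set L B N)" for F
    by (simp add: nested_set_complex_def M_def)
  have mnest: "N \<in> maximal_nested_sets L B \<longleftrightarrow>
      nested_set L B N \<and> (\<forall>N'. nested_set L B N' \<longrightarrow> \<not> N \<subset> N')" for N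
    by (simp add: maximal_nested_sets_def mem)
  have ball: "(\<forall>Y\<in>nested_set_complex L B. \<not> F \<subset> Y) \<longleftrightarrow>
      (\<forall>N'. nested_set L B N' \<longrightarrow> \<not> F \<subset> N' - M)" for F
    by (auto simp: face)
  have "F \<in> facets (nested_set_complex L B) \<longleftrightarrow>
      (\<exists>N. F = N - M \<and> N \<in> maximal_nested_sets L B)" (is "?l \<longleftrightarrow> ?r") for F
  proof
    assume ?l
    then obtain N where N: "F = N - M" "nested_set L B N"
      and F: "\<forall>N'. nested_set L B N' \<longrightarrow> \<not> F \<subset> N' - M"
      unfolding mem ball face by (elim conjE exE)
    have "\<not> N \<subset> N'" if "nested_set L B N'" for N'
      using F[rule_format, OF that] iff[OF N(2) that] N(1) by simp
    with N show ?r unfolding mnest by (intro exI[of _ N] conjI allI impI)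
  next
    assume ?r
    then obtain N where N: "F = N - M" "nested_set L B N"
      and F: "\<forall>N'. nested_set L B N' \<longrightarrow> \<not> N \<subset> N'"
      unfolding mnest by (elim conjE exE)
    have "\<not> F \<subset> N' - M" if "nested_set L B N'" for N'
      using F[rule_format, OF that] iff[OF N(2) that] N(1) by simp
    with N show ?l unfolding mem ball face by (intro exI[of _ N] conjI allI impI)
  qed
  then show ?thesis by (auto simp: M_def)
qed

end

theory Submission
  imports Defs
begin

text \<open>
  A nested set \<open>N\<close> is a forest under inclusion, and it partitions the ground set into blocks: the
  block of \<open>X \<in> N\<close> is \<open>X\<close> minus the smaller members. If \<open>X\<close> has parent \<open>P\<close>, then the difference of
  the vertices of \<open>N\<close> and \<open>N - {X}\<close> lies in the span of \<open>N\<close> and is orthogonal to all other members,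
  since both vertices satisfy the same equations there. Up to a positive factor this leaves only
  one vector: the uniform distribution on the block of \<open>X\<close> minus the one on the block of \<open>P\<close>
  (\<open>edge_direction\<close>, \<open>vert_edge\<close>). So the function \<open>\<phi>\<close> affects the lengths of the edges of the
  normal complex, but not their directions. Lexicographically, the vertex of \<open>N\<close> precedes the
  vertex of \<open>N - {X}\<close> if the block of \<open>X\<close> has a smaller minimum than the block of \<open>P\<close>, an ascent, and
  succeeds it otherwise, a descent.

  Two combinatorial facts then give the shelling.

  Exchange: at a descent \<open>X\<close> of a maximal nested set \<open>N\<close> there is another maximal nested set
  containing \<open>N - {X}\<close> in which the smallest element of the merged block belongs to the new member
  (\<open>nested_exchange\<close>). Both edges at the vertex of \<open>N - {X}\<close> go in the right direction, so the new
  vertex precedes the old one (\<open>descent_improves\<close>).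

  Uniqueness: two maximal nested sets all of whose members outside their intersection are ascents
  are equal (\<open>ascending_unique\<close>). Such a nested set can be built greedily from the
  intersection, adding the component around the smallest available element.

  Now let \<open>N'\<close> precede \<open>N\<close>, and consider the first maximal nested set \<open>Q\<close> containing \<open>N \<inter> N'\<close>.
  By exchange \<open>Q\<close> has no descents outside \<open>N \<inter> N'\<close>. If all members of \<open>N\<close> outside \<open>N'\<close> were
  ascents, uniqueness would give \<open>N = Q\<close>, although \<open>N'\<close> comes earlier. So \<open>N\<close> has a descent \<open>X\<close>
  outside \<open>N'\<close> (\<open>ex_descent\<close>), and exchanging at \<open>X\<close> gives the facet required of a shelling. The same
  argument with the maximal nested sets of a fixed size shows purity. Linearity of the
  order amounts to distinctness of the vertices, which holds as superlevel sets of a point in the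
  interior of a cone recover the nested set (\<open>interior_determines_nested_set\<close>).

  The combinatorics rests on one consequence of the building isomorphisms: the union of any members
  of a nested set is a flat, and its components are the maximal ones among these members
  (\<open>nested_Union\<close>).
\<close>

section \<open>Inclusion-maximal members of a family\<close>

lemma maximal_elems_iff: "X \<in> maximal_elems S \<longleftrightarrow> X \<in> S \<and> (\<forall>Y\<in>S. X \<subseteq> Y \<longrightarrow> X = Y)"
  unfolding maximal_elems_def psubset_eq by blast

lemma ex_maximal_above:
  assumes "finite S" "X \<in> S"
  shows "\<exists>Y\<in>maximal_elems S. X \<subseteq> Y"
proof -
  obtain Y where "Y \<in> S" "X \<subseteq> Y" "\<forall>Z\<in>S. Y \<subseteq> Z \<longrightarrow> Y = Z"
    using finite_has_maximal2[OF assms] by metis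
  then have "Y \<in> maximal_elems S" by (simp add: maximal_elems_iff)
  then show ?thesis using \<open>X \<subseteq> Y\<close> by blast
qed

lemma Union_maximal_elems:
  assumes "finite S"
  shows "\<Union>(maximal_elems S) = \<Union>S"
proof
  show "\<Union>(maximal_elems S) \<subseteq> \<Union>S" by (auto simp: maximal_elems_def)
  show "\<Union>S \<subseteq> \<Union>(maximal_elems S)" using ex_maximal_above[OF assms] by blast
qed

section \<open>Closure in a matroid\<close>

context matroid
begin

definition cl :: "'e set \<Rightarrow> 'e set" where
  "cl A = \<Inter>{F \<in> flats E indep. A \<subseteq> F}"

lemma join_eq_cl: "join (flats E indep) S = cl (\<Union>S)"
  by (simp add: join_def cl_def)

lemma flat_subset_ground: "F \<in> flats E indep \<Longrightarrow> F \<subseteq> E"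
  by (simp add: flats_def)

lemma cl_flat: "A \<subseteq> E \<Longrightarrow> cl A \<in> flats E indep"
  unfolding cl_def using ground_flat by (intro Inter_flats) auto

lemma subset_cl: "A \<subseteq> cl A"
  by (auto simp: cl_def)

lemma cl_least: "F \<in> flats E indep \<Longrightarrow> A \<subseteq> F \<Longrightarrow> cl A \<subseteq> F"
  by (auto simp: cl_def)

lemma cl_of_flat: "F \<in> flats E indep \<Longrightarrow> cl F = F"
  using cl_least subset_cl by blast

lemma cl_mono: "A \<subseteq> A' \<Longrightarrow> cl A \<subseteq> cl A'"
  by (auto simp: cl_def)

lemma inter_flat: "F \<in> flats E indep \<Longrightarrow> G \<in> flats E indep \<Longrightarrow> F \<inter> G \<in> flats E indep"
  using Inter_flats[of "{F, G}"] by simp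

lemma rank_mono: "A \<subseteq> A' \<Longrightarrow> rank_of indep A \<le> rank_of indep A'"
  using rank_attained[of A] card_le_rank by (metis subset_trans)

lemma rank_insert_le: "rank_of indep (insert x A) \<le> Suc (rank_of indep A)"
proof -
  obtain I where I: "indep I" "I \<subseteq> insert x A" "card I = rank_of indep (insert x A)"
    using rank_attained by blast
  have "card (I - {x}) \<le> rank_of indep A"
    using I(1,2) by (intro card_le_rank) (auto intro: indep_mono)
  moreover have "card (I - {x}) \<ge> card I - 1"
    by (cases "x \<in> I") (simp_all add: card_Diff_singleton_if)
  ultimately show ?thesis using I(3) by linarith
qed

lemma rank_closure_of_set:
  assumes "A \<subseteq> E"
  shows "rank_of indep (closure_of_set E indep A) = rank_of indep A"
proof -
  let ?C = "closure_of_set E indep A"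
  have AC: "A \<subseteq> ?C" using assms by (auto simp: closure_of_set_def insert_absorb)
  obtain I where I: "indep I" "I \<subseteq> A" "card I = rank_of indep A"
    using rank_attained by blast
  obtain J where J: "indep J" "I \<subseteq> J" "J \<subseteq> ?C" "card J = rank_of indep ?C"
    using extend_to_basis[of I ?C] I AC by blast
  have "J \<subseteq> I"
  proof
    fix x assume x: "x \<in> J"
    show "x \<in> I"
    proof (rule ccontr)
      assume "x \<notin> I"
      have "indep (insert x I)" using J(1,2) x by (auto intro: indep_mono)
      then have "card (insert x I) \<le> rank_of indep (insert x A)"
        using I(2) by (intro card_le_rank) auto
      moreover have "x \<in> ?C" using x J(3) by blast
      ultimately show False
        using I(3) \<open>x \<notin> I\<close> indep_finite[OF I(1)] by (simp add: closure_of_set_def)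
    qed
  qed
  with J I show ?thesis by (metis subset_antisym)
qed

text \<open>Flats are defined through the rank-based closure, joins through least flats. The two closures
  agree because the rank-based one does not increase the rank and is therefore idempotent; this
  makes rank computations available for joins.\<close>

lemma cl_eq_closure_of_set:
  assumes "A \<subseteq> E"
  shows "cl A = closure_of_set E indep A"
proof
  let ?C = "closure_of_set E indep A"
  have AC: "A \<subseteq> ?C" using assms by (auto simp: closure_of_set_def insert_absorb)
  have CE: "?C \<subseteq> E" by (auto simp: closure_of_set_def)
  have "closure_of_set E indep ?C \<subseteq> ?C"
  proof
    fix x assume x: "x \<in> closure_of_set E indep ?C"
    then have "rank_of indep (insert x ?C) = rank_of indep A"
      using rank_closure_of_set[OF assms] by (simp add: closure_of_set_def)
    moreover have "rank_of indep (insert x A) \<le> rank_of indep (insert x ?C)"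
      using AC by (intro rank_mono) auto
    moreover have "rank_of indep A \<le> rank_of indep (insert x A)"
      by (intro rank_mono) auto
    ultimately show "x \<in> ?C" using x by (simp add: closure_of_set_def)
  qed
  moreover have "?C \<subseteq> closure_of_set E indep ?C"
    using CE by (auto simp: closure_of_set_def insert_absorb)
  ultimately have "?C \<in> flats E indep" using CE by (auto simp: flats_def)
  then show "cl A \<subseteq> ?C" using AC by (rule cl_least)
  show "?C \<subseteq> cl A"
    unfolding cl_def
  proof (rule Inter_greatest)
    fix F assume "F \<in> {F \<in> flats E indep. A \<subseteq> F}"
    then show "?C \<subseteq> F" using closure_mono[of A F] by (auto simp: flats_def)
  qed
qed

text \<open>The Steinitz exchange property: a flat is covered by the flats obtained from it by adding
  one element, and these covers partition the remaining elements. The reason is that both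
  elements raise the rank of the flat by exactly one.\<close>

lemma cl_exchange:
  assumes F: "F \<in> flats E indep" and i: "i \<in> E" and j: "j \<in> cl (insert i F)" "j \<notin> F"
  shows "i \<in> cl (insert j F)"
proof -
  let ?r = "rank_of indep"
  have FE: "F \<subseteq> E" using F by (rule flat_subset_ground)
  have jC: "j \<in> closure_of_set E indep (insert i F)"
    using j(1) cl_eq_closure_of_set[of "insert i F"] FE i by simp
  then have jE: "j \<in> E" and r: "?r (insert j (insert i F)) = ?r (insert i F)"
    by (auto simp: closure_of_set_def)
  have "?r (insert j F) \<noteq> ?r F"
    using F j(2) jE by (auto simp: flats_def closure_of_set_def)
  moreover have "?r F \<le> ?r (insert j F)" by (rule rank_mono) blast
  ultimately have "Suc (?r F) \<le> ?r (insert j F)" by linarith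
  with r rank_insert_le[of i F] have "?r (insert i (insert j F)) \<le> ?r (insert j F)"
    by (simp add: insert_commute)
  moreover have "?r (insert j F) \<le> ?r (insert i (insert j F))" by (rule rank_mono) blast
  ultimately have "?r (insert i (insert j F)) = ?r (insert j F)" by linarith
  then have "i \<in> closure_of_set E indep (insert j F)"
    using i by (simp add: closure_of_set_def)
  then show ?thesis using cl_eq_closure_of_set[of "insert j F"] FE jE by simp
qed

end

section \<open>Components of a flat and nested sets\<close>

locale built_matroid = matroid E indep
  for E :: "'e set" and indep :: "'e set \<Rightarrow> bool" +
  fixes B :: "'e set set"
  assumes no_loops: "loopless E indep"
    and building: "building_set (flats E indep) B"
begin

abbreviation L :: "'e set set" where
  "L \<equiv> flats E indep"

definition comps :: "'e set \<Rightarrow> 'e set set" where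
  "comps X = maximal_elems {Y \<in> B. Y \<subseteq> X}"

lemma B_flat: "X \<in> B \<Longrightarrow> X \<in> L"
  using building by (auto simp: building_set_def)

lemma B_nonempty: "X \<in> B \<Longrightarrow> X \<noteq> {}"
  using building by (auto simp: building_set_def)

lemma B_subset_ground: "X \<in> B \<Longrightarrow> X \<subseteq> E"
  using B_flat flat_subset_ground by blast

lemma finite_B: "finite B"
  using finite_ground B_subset_ground by (intro finite_subset[of B "Pow E"]) auto

lemma comps_in_B: "Y \<in> comps X \<Longrightarrow> Y \<in> B \<and> Y \<subseteq> X"
  by (simp add: comps_def maximal_elems_def)

lemma comps_maximal: "Y \<in> comps X \<Longrightarrow> Z \<in> B \<Longrightarrow> Z \<subseteq> X \<Longrightarrow> Y \<subseteq> Z \<Longrightarrow> Y = Z"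
  by (auto simp: comps_def maximal_elems_iff)

lemma ex_comp_above: "Z \<in> B \<Longrightarrow> Z \<subseteq> X \<Longrightarrow> \<exists>Y\<in>comps X. Z \<subseteq> Y"
  unfolding comps_def using finite_B by (intro ex_maximal_above) auto

lemma self_comp: "X \<in> B \<Longrightarrow> comps X = {X}"
  by (auto simp: comps_def maximal_elems_iff)

lemma cl_empty: "cl {} = {}"
  using bottom_flat[OF no_loops] by (rule cl_of_flat)

lemma building_isomorphism:
  assumes "X \<in> L" "X \<noteq> {}"
  shows "bij_betw (\<lambda>z. cl (\<Union>(z ` comps X))) (\<Pi>\<^sub>E Y\<in>comps X. below L Y) (below L X)"
  using building assms by (simp add: building_set_def comps_def Let_def join_eq_cl)

text \<open>Injectivity of the building isomorphism says that shrinking a component of a flat shrinks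
  the join. It suffices to compare the given tuple with the tuple of all components.\<close>

lemma comps_tight:
  assumes X: "X \<in> L" and z: "\<And>Y. Y \<in> comps X \<Longrightarrow> z Y \<in> L \<and> z Y \<subseteq> Y"
    and le: "X \<subseteq> cl (\<Union>Y\<in>comps X. z Y)" and Y: "Y \<in> comps X"
  shows "z Y = Y"
proof -
  let ?I = "comps X" and ?f = "\<lambda>z. cl (\<Union>(z ` comps X))"
  have "X \<noteq> {}" using Y comps_in_B B_nonempty by blast
  then have bij: "bij_betw ?f (\<Pi>\<^sub>E Y\<in>?I. below L Y) (below L X)"
    using building_isomorphism X by blast
  have X_ub: "cl (\<Union>Y\<in>?I. w Y) \<subseteq> X" if "\<And>Y. Y \<in> ?I \<Longrightarrow> w Y \<subseteq> Y" for w
    using that comps_in_B by (intro cl_least[OF X]) blast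
  let ?z = "restrict z ?I" and ?w = "restrict id ?I"
  have "(\<Union>Y\<in>?I. z Y) \<subseteq> (\<Union>Y\<in>?I. Y)" using z by blast
  then have "X \<subseteq> cl (\<Union>Y\<in>?I. Y)" using le cl_mono by blast
  then have "?f ?w = X" using X_ub[of "\<lambda>Y. Y"] by auto
  moreover have "?f ?z = X" using X_ub[of z] z le by auto
  moreover have "?z \<in> (\<Pi>\<^sub>E Y\<in>?I. below L Y)" using z by (auto simp: below_def)
  moreover have "?w \<in> (\<Pi>\<^sub>E Y\<in>?I. below L Y)"
    using comps_in_B B_flat by (auto simp: below_def)
  ultimately have "?z = ?w" using inj_onD[OF bij_betw_imp_inj_on[OF bij], of ?z ?w] by simp
  then have "?z Y = ?w Y" by simp
  then show ?thesis using Y by simp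
qed

text \<open>The intersection of two components is a flat below each of them. Placing it in either
  coordinate of an otherwise empty tuple gives the same join, so by injectivity it is empty.\<close>

lemma comps_disjoint:
  assumes X: "X \<in> L" and Y: "Y1 \<in> comps X" "Y2 \<in> comps X" "Y1 \<noteq> Y2"
  shows "Y1 \<inter> Y2 = {}"
proof -
  let ?I = "comps X" and ?f = "\<lambda>z. cl (\<Union>(z ` comps X))" and ?K = "Y1 \<inter> Y2"
  have "X \<noteq> {}" using Y comps_in_B B_nonempty by blast
  then have bij: "bij_betw ?f (\<Pi>\<^sub>E Y\<in>?I. below L Y) (below L X)"
    using building_isomorphism X by blast
  define z where "z Y0 = (\<lambda>Y\<in>?I. if Y = Y0 then ?K else {})" for Y0
  have "Y1 \<in> L" "Y2 \<in> L" using Y comps_in_B B_flat by blast+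
  then have K: "?K \<in> L" by (rule inter_flat)
  have zP: "z Y1 \<in> (\<Pi>\<^sub>E Y\<in>?I. below L Y)" "z Y2 \<in> (\<Pi>\<^sub>E Y\<in>?I. below L Y)"
    using K bottom_flat[OF no_loops] by (auto simp: z_def below_def)
  have "\<Union>(z Y1 ` ?I) = ?K" "\<Union>(z Y2 ` ?I) = ?K"
    using Y by (auto simp: z_def split: if_splits)
  then have "z Y1 = z Y2"
    using inj_onD[OF bij_betw_imp_inj_on[OF bij], of "z Y1" "z Y2"] zP by simp
  then have "z Y1 Y1 = z Y2 Y1" by simp
  then show ?thesis using Y by (simp add: z_def)
qed

text \<open>Surjectivity of the building isomorphism puts every atom, hence every element, below a
  component.\<close>

lemma Union_comps:
  assumes X: "X \<in> L"
  shows "\<Union>(comps X) = X"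
proof
  show "\<Union>(comps X) \<subseteq> X" using comps_in_B by blast
  show "X \<subseteq> \<Union>(comps X)"
  proof
    fix i assume i: "i \<in> X"
    let ?f = "\<lambda>z. cl (\<Union>(z ` comps X))"
    have bij: "bij_betw ?f (\<Pi>\<^sub>E Y\<in>comps X. below L Y) (below L X)"
      using building_isomorphism X i by blast
    have iE: "i \<in> E" using i X flat_subset_ground by blast
    have "cl {i} \<in> below L X"
      using cl_flat[of "{i}"] cl_least[OF X, of "{i}"] i iE by (simp add: below_def)
    then obtain z where z: "z \<in> (\<Pi>\<^sub>E Y\<in>comps X. below L Y)" "?f z = cl {i}"
      using bij_betw_imp_surj_on[OF bij] by (metis (no_types, lifting) imageE)
    have "\<Union>(z ` comps X) \<noteq> {}"
    proof
      assume "\<Union>(z ` comps X) = {}"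
      then have "cl {i} = {}" using z(2) cl_empty by simp
      then show False using subset_cl[of "{i}"] by simp
    qed
    then obtain Y j where Yj: "Y \<in> comps X" "j \<in> z Y" by blast
    have zY: "z Y \<in> L" "z Y \<subseteq> Y" using z(1) Yj(1) by (auto simp: below_def)
    have "j \<in> cl {i}" using Yj subset_cl[of "\<Union>(z ` comps X)"] z(2) by auto
    then have "i \<in> cl {j}"
      using cl_exchange[OF bottom_flat[OF no_loops] iE] by blast
    also have "cl {j} \<subseteq> z Y" using cl_least[OF zY(1)] Yj(2) by blast
    finally show "i \<in> \<Union>(comps X)" using zY(2) Yj(1) by blast
  qed
qed

lemma nested_subset_B: "nested_set L B N \<Longrightarrow> N \<subseteq> B"
  by (simp add: nested_set_def)

lemma nested_finite: "nested_set L B N \<Longrightarrow> finite N"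
  using finite_B finite_subset nested_subset_B by blast

lemma nested_mono:
  "nested_set L B N \<Longrightarrow> N' \<subseteq> N \<Longrightarrow> maximal_elems B \<subseteq> N' \<Longrightarrow> nested_set L B N'"
  by (simp add: nested_set_def) (meson subset_trans)

text \<open>Consider the maximal members of \<open>T\<close> and their join. The members inside one component of
  the join have that component as their join, by tightness; as it lies in \<open>B\<close>, nestedness leaves
  room for just one such member. So the maximal members of \<open>T\<close> are the components of the join, and
  as the components of a flat cover it, the join is the plain union. Nearly everything below is
  deduced from this.\<close>

lemma nested_Union:
  assumes N: "nested_set L B N" and T: "T \<subseteq> N"
  shows nested_Union_flat: "\<Union>T \<in> L"
    and nested_Union_comps: "comps (\<Union>T) = maximal_elems T"
proof -
  define S where "S = maximal_elems T"
  have finT: "finite T" using N T nested_finite finite_subset by blast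
  have SN: "S \<subseteq> N" using T by (auto simp: S_def maximal_elems_def)
  have SB: "S \<subseteq> B" using SN nested_subset_B[OF N] by blast
  have US: "\<Union>S = \<Union>T" using Union_maximal_elems[OF finT] by (simp add: S_def)
  have anti: "X \<subseteq> Y \<Longrightarrow> X = Y" if "X \<in> S" "Y \<in> S" for X Y
    using that by (auto simp: S_def maximal_elems_iff)
  define J where "J = cl (\<Union>S)"
  have J: "J \<in> L" unfolding J_def using SB B_subset_ground by (intro cl_flat) blast
  define z where "z Y = cl (\<Union>{s\<in>S. s \<subseteq> Y})" for Y
  have sub: "\<Union>S \<subseteq> (\<Union>Y\<in>comps J. z Y)"
  proof
    fix i assume "i \<in> \<Union>S"
    then obtain s where s: "s \<in> S" "i \<in> s" by blast
    have "s \<subseteq> J" using s subset_cl[of "\<Union>S"] by (auto simp: J_def)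
    then obtain Y where Y: "Y \<in> comps J" "s \<subseteq> Y" using ex_comp_above s SB by blast
    have "s \<subseteq> z Y" using s Y subset_cl[of "\<Union>{s\<in>S. s \<subseteq> Y}"] by (auto simp: z_def)
    then show "i \<in> (\<Union>Y\<in>comps J. z Y)" using Y s by blast
  qed
  have zY: "z Y = Y" if Y: "Y \<in> comps J" for Y
  proof (rule comps_tight[OF J _ _ Y])
    fix Y assume "Y \<in> comps J"
    then have YB: "Y \<in> B" using comps_in_B by blast
    show "z Y \<in> L \<and> z Y \<subseteq> Y"
      unfolding z_def using B_flat[OF YB] B_subset_ground[OF YB]
      by (intro conjI cl_flat cl_least) auto
  next
    show "J \<subseteq> cl (\<Union>Y\<in>comps J. z Y)" using cl_mono[OF sub] by (simp add: J_def)
  qed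
  have compS: "Y \<in> S" if Y: "Y \<in> comps J" for Y
  proof -
    let ?T = "{s\<in>S. s \<subseteq> Y}"
    have YB: "Y \<in> B" using Y comps_in_B by blast
    have eq: "cl (\<Union>?T) = Y" using zY[OF Y] by (simp add: z_def)
    have "\<not> card ?T \<ge> 2"
    proof
      assume "card ?T \<ge> 2"
      moreover have "pairwise (\<lambda>X Y. \<not> X \<subseteq> Y \<and> \<not> Y \<subseteq> X) ?T"
        using anti by (auto simp: pairwise_def)
      moreover have "?T \<subseteq> N" using SN by blast
      ultimately have "join L ?T \<notin> B" using N unfolding nested_set_def by blast
      then show False using eq YB by (simp add: join_eq_cl)
    qed
    moreover have "?T \<noteq> {}" using eq B_nonempty[OF YB] cl_empty by fastforce
    moreover have "finite ?T" using finT by (simp add: S_def maximal_elems_def)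
    ultimately have "card ?T < 2" "card ?T \<noteq> 0" by simp_all
    then have "card ?T = 1" by linarith
    then obtain s where s: "?T = {s}" using card_1_singletonE by blast
    then have sS: "s \<in> S" by blast
    have "cl s = Y" using eq s by simp
    moreover have "cl s = s" using sS SB B_flat by (intro cl_of_flat) blast
    ultimately show ?thesis using sS by simp
  qed
  have comps: "comps J = S"
  proof
    show "comps J \<subseteq> S" using compS by blast
    show "S \<subseteq> comps J"
    proof
      fix s assume s: "s \<in> S"
      have "s \<subseteq> J" using s subset_cl[of "\<Union>S"] by (auto simp: J_def)
      then obtain Y where Y: "Y \<in> comps J" "s \<subseteq> Y" using ex_comp_above s SB by blast
      then show "s \<in> comps J" using anti[OF s compS[OF Y(1)]] by simp
    qed
  qed
  have "J = \<Union>T" using Union_comps[OF J] comps US by simp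
  then show "\<Union>T \<in> L" "comps (\<Union>T) = maximal_elems T" using J comps by (simp_all add: S_def)
qed

lemma nested_cases:
  assumes N: "nested_set L B N" and XY: "X \<in> N" "Y \<in> N" and meet: "i \<in> X" "i \<in> Y"
  shows "X \<subseteq> Y \<or> Y \<subseteq> X"
proof (rule ccontr)
  assume "\<not> ?thesis"
  then have "maximal_elems {X, Y} = {X, Y}" by (auto simp: maximal_elems_iff)
  then have c: "comps (X \<union> Y) = {X, Y}" and f: "X \<union> Y \<in> L"
    using nested_Union[OF N, of "{X, Y}"] XY by simp_all
  have "X \<inter> Y = {}" using comps_disjoint[OF f, of X Y] c \<open>\<not> (X \<subseteq> Y \<or> Y \<subseteq> X)\<close> by blast
  then show False using meet by blast
qed

section \<open>The forest of a nested set\<close>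

definition under :: "'e set set \<Rightarrow> 'e set \<Rightarrow> 'e set" where
  "under N X = \<Union>{Y \<in> N. Y \<subset> X}"

text \<open>The members of a nested set form a forest under inclusion, by \<open>nested_cases\<close>. The sets
  \<open>own N X\<close> for \<open>X \<in> N\<close> are the blocks of a partition of \<open>\<Union>N\<close>, and the linear span of the
  indicator vectors of \<open>N\<close> consists of the vectors that are constant on these blocks and vanish
  outside \<open>\<Union>N\<close>.\<close>

definition own :: "'e set set \<Rightarrow> 'e set \<Rightarrow> 'e set" where
  "own N X = X - under N X"

definition parent :: "'e set set \<Rightarrow> 'e set \<Rightarrow> 'e set \<Rightarrow> bool" where
  "parent N X P \<longleftrightarrow> P \<in> N \<and> X \<subset> P \<and> (\<forall>Y\<in>N. X \<subset> Y \<longrightarrow> P \<subseteq> Y)"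

lemma under_flat: "nested_set L B N \<Longrightarrow> under N X \<in> L"
  unfolding under_def by (rule nested_Union_flat) auto

lemma under_subset: "under N X \<subseteq> X"
  by (auto simp: under_def)

lemma own_subset: "own N X \<subseteq> X"
  by (auto simp: own_def)

lemma own_memD: "i \<in> own N X \<Longrightarrow> i \<in> X"
  by (simp add: own_def)

text \<open>Otherwise \<open>X\<close> would be the union of smaller members of \<open>N\<close>, which are then its components;
  but \<open>X\<close> lies in \<open>B\<close> and is its own component.\<close>

lemma own_nonempty:
  assumes N: "nested_set L B N" and X: "X \<in> N"
  shows "own N X \<noteq> {}"
proof
  assume "own N X = {}"
  then have "under N X = X" using under_subset[of N X] by (auto simp: own_def)
  then have "comps X = maximal_elems {Y \<in> N. Y \<subset> X}"
    using nested_Union_comps[OF N, of "{Y \<in> N. Y \<subset> X}"] by (auto simp: under_def)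
  moreover have "X \<in> comps X" using self_comp X nested_subset_B[OF N] by blast
  ultimately show False by (auto simp: maximal_elems_def)
qed

lemma nested_least_above:
  assumes N: "nested_set L B N" and A: "A \<noteq> {}" and Z: "Z \<in> N" "A \<subseteq> Z"
  shows "\<exists>P\<in>N. A \<subseteq> P \<and> (\<forall>Y\<in>N. A \<subseteq> Y \<longrightarrow> P \<subseteq> Y)"
proof -
  have "finite {Y \<in> N. A \<subseteq> Y}" using nested_finite[OF N] by simp
  then obtain P where P: "P \<in> {Y \<in> N. A \<subseteq> Y}" "\<forall>Y\<in>{Y \<in> N. A \<subseteq> Y}. Y \<subseteq> P \<longrightarrow> P = Y"
    using finite_has_minimal2[of "{Y \<in> N. A \<subseteq> Y}" Z] Z by (metis (no_types, lifting) mem_Collect_eq)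
  have "P \<subseteq> Y" if Y: "Y \<in> N" "A \<subseteq> Y" for Y
  proof -
    obtain i where "i \<in> A" using A by blast
    then have "P \<subseteq> Y \<or> Y \<subseteq> P" using nested_cases[OF N, of P Y i] P(1) Y by blast
    then show ?thesis using P(2) Y by auto
  qed
  then show ?thesis using P(1) by blast
qed

lemma ex_owner:
  assumes N: "nested_set L B N" and Z: "Z \<in> N" "i \<in> Z"
  shows "\<exists>Y\<in>N. Y \<subseteq> Z \<and> i \<in> own N Y"
proof -
  obtain Y where Y: "Y \<in> N" "i \<in> Y" "\<forall>Y'\<in>N. i \<in> Y' \<longrightarrow> Y \<subseteq> Y'"
    using nested_least_above[OF N, of "{i}" Z] Z by auto
  then have "i \<in> own N Y" by (auto simp: own_def under_def)
  then show ?thesis using Y Z by blast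
qed

lemma own_member_iff:
  assumes N: "nested_set L B N" and Y: "Y \<in> N" "i \<in> own N Y" and Z: "Z \<in> N"
  shows "i \<in> Z \<longleftrightarrow> Y \<subseteq> Z"
proof
  assume iZ: "i \<in> Z"
  have "i \<in> Y" using Y(2) by (rule own_memD)
  then have "Y \<subseteq> Z \<or> Z \<subset> Y" using nested_cases[OF N Y(1) Z _ iZ] by blast
  then show "Y \<subseteq> Z" using Y(2) Z iZ by (auto simp: own_def under_def)
next
  assume "Y \<subseteq> Z" then show "i \<in> Z" using own_memD[OF Y(2)] by blast
qed

lemma own_disjoint:
  assumes N: "nested_set L B N" and "Y \<in> N" "i \<in> own N Y" and "Z \<in> N" "i \<in> own N Z"
  shows "Y = Z"
proof -
  have "i \<in> Y" "i \<in> Z" using own_memD[OF assms(3)] own_memD[OF assms(5)] by simp_all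
  then show ?thesis using own_member_iff[OF N] assms by (metis subset_antisym)
qed

lemma ex_max_above: "X \<in> B \<Longrightarrow> \<exists>Y\<in>maximal_elems B. X \<subseteq> Y"
  using ex_maximal_above[OF finite_B] .

lemma parent_not_max: "nested_set L B N \<Longrightarrow> parent N X P \<Longrightarrow> X \<notin> maximal_elems B"
  using nested_subset_B by (auto simp: parent_def maximal_elems_def)

lemma nested_remove:
  assumes N: "nested_set L B N" and p: "parent N X P"
  shows "nested_set L B (N - {X})"
  using N parent_not_max[OF N p] by (intro nested_mono[OF N]) (auto simp: nested_set_def)

text \<open>Removing \<open>X\<close> merges its block into the block of its parent and changes nothing else.\<close>

lemma under_remove_other:
  assumes p: "parent N X P" and Y: "Y \<in> N" "Y \<noteq> P"
  shows "under N Y = under (N - {X}) Y"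
proof -
  have "X \<subseteq> under (N - {X}) Y" if "X \<subset> Y"
  proof -
    have "P \<subset> Y" "P \<in> N - {X}" "X \<subset> P" using p Y that by (auto simp: parent_def)
    then show ?thesis by (auto simp: under_def)
  qed
  then show ?thesis by (auto simp: under_def)
qed

lemma under_parent:
  assumes p: "parent N X P" and X: "X \<in> N"
  shows "under N P = X \<union> under (N - {X}) P"
  using p X by (auto simp: under_def parent_def)

lemma under_child:
  assumes N: "nested_set L B N" and p: "parent N X P" and X: "X \<in> N"
  shows "under N X = X \<inter> under (N - {X}) P"
proof -
  have "Y \<subset> X" if "Y \<in> N - {X}" "Y \<subset> P" "i \<in> X" "i \<in> Y" for Y i
    using nested_cases[OF N, of X Y i] that X p by (auto simp: parent_def)
  moreover have "X \<subset> P" using p by (simp add: parent_def)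
  ultimately show ?thesis unfolding under_def by blast
qed

lemma own_merge:
  assumes N: "nested_set L B N" and p: "parent N X P" and X: "X \<in> N"
  shows "own N P \<union> own N X = own (N - {X}) P"
proof -
  have "X \<subset> P" using p by (simp add: parent_def)
  then show ?thesis
    unfolding own_def under_parent[OF p X] under_child[OF assms] by blast
qed

section \<open>Maximal nested sets and exchanges\<close>

text \<open>The basic way to enlarge a nested set: pick an element \<open>i\<close> in the block of \<open>P\<close>, close it
  together with everything strictly below \<open>P\<close>, and add the component of \<open>i\<close>. Suppose that an
  antichain containing the new member \<open>X\<close> had its join in \<open>B\<close>. Then the join would lie in a single
  component of every flat containing the antichain. For the union of the antichain with \<open>P\<close> in
  place of \<open>X\<close> this means that all its members lie below \<open>P\<close>; for the closure just formed it means
  that \<open>X\<close> is the whole join, contrary to incomparability.\<close>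

lemma nested_insert:
  assumes R: "nested_set L B R" and P: "P \<in> R" and i: "i \<in> own R P"
    and X: "X \<in> comps (cl (insert i (under R P)))" and iX: "i \<in> X"
  shows "nested_set L B (insert X R)"
proof -
  let ?J = "cl (insert i (under R P))"
  have XB: "X \<in> B" and XJ: "X \<subseteq> ?J" using X comps_in_B by blast+
  have PB: "P \<in> B" using P nested_subset_B[OF R] by blast
  have JP: "?J \<subseteq> P"
    using i under_subset[of R P] own_subset[of R P] by (intro cl_least B_flat[OF PB]) blast
  have "join L S \<notin> B" if S: "S \<subseteq> insert X R" "card S \<ge> 2"
    "pairwise (\<lambda>X Y. \<not> X \<subseteq> Y \<and> \<not> Y \<subseteq> X) S" for S
  proof (cases "X \<in> S")
    case False
    then have "S \<subseteq> R" using S(1) by blast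
    then show ?thesis using R S(2,3) by (simp add: nested_set_def)
  next
    case True
    let ?K = "cl (\<Union>S)"
    show ?thesis
    proof
      assume "join L S \<in> B"
      then have KB: "?K \<in> B" by (simp add: join_eq_cl)
      have le: "Y \<subseteq> ?K" if "Y \<in> S" for Y using that subset_cl[of "\<Union>S"] by blast
      have incomp: "\<not> X \<subseteq> Y \<and> \<not> Y \<subseteq> X" if "Y \<in> S - {X}" for Y
        using S(3) True that by (auto simp: pairwise_def)
      have "S \<noteq> {X}" using S(2) by auto
      then obtain Y where Y: "Y \<in> S - {X}" using True by blast
      \<comment> \<open>Trading \<open>X\<close> for \<open>P\<close> gives a union of members of \<open>R\<close>, whose components are known.\<close>
      let ?T = "insert P (S - {X})"
      have TR: "?T \<subseteq> R" using P S(1) by blast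
      have "\<Union>S \<subseteq> \<Union>?T" using XJ JP by blast
      then have "?K \<subseteq> \<Union>?T" using nested_Union_flat[OF R TR] by (rule cl_least[rotated])
      then obtain Z where Z: "Z \<in> comps (\<Union>?T)" "?K \<subseteq> Z" using ex_comp_above[OF KB] by blast
      then have "Z \<in> ?T" using nested_Union_comps[OF R TR] by (auto simp: maximal_elems_def)
      moreover have "X \<subseteq> Z" using le[OF True] Z(2) by blast
      ultimately have "Z = P" using incomp by blast
      have below: "Y' \<subseteq> ?J" if Y': "Y' \<in> S - {X}" for Y'
      proof -
        have "Y' \<subseteq> P" using le Y' Z(2) \<open>Z = P\<close> by blast
        moreover have "Y' \<noteq> P" using incomp[OF Y'] XJ JP by blast
        ultimately have "Y' \<subseteq> under R P" using Y' S(1) by (auto simp: under_def)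
        then show ?thesis using subset_cl[of "insert i (under R P)"] by blast
      qed
      have "?K \<subseteq> ?J"
      proof (rule cl_least)
        have "insert i (under R P) \<subseteq> E"
          using i under_subset[of R P] own_subset[of R P] B_subset_ground[OF PB] by blast
        then show "?J \<in> L" by (rule cl_flat)
        show "\<Union>S \<subseteq> ?J" using below XJ by blast
      qed
      then have "X = ?K" using comps_maximal[OF X KB] le[OF True] by blast
      then show False using le Y incomp by blast
    qed
  qed
  then show ?thesis using R XB by (auto simp: nested_set_def)
qed

lemma maximal_nested_iff:
  "N \<in> maximal_nested_sets L B \<longleftrightarrow>
     nested_set L B N \<and> (\<forall>N'. nested_set L B N' \<longrightarrow> N \<subseteq> N' \<longrightarrow> N = N')"
  by (auto simp: maximal_nested_sets_def maximal_elems_iff)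

text \<open>In a maximal nested set the enlargement of \<open>nested_insert\<close> adds nothing new, so its new
  member is \<open>X\<close> itself. In other words, \<open>X\<close> covers the flat \<open>under N X\<close>.\<close>

lemma maximal_nested_cover:
  assumes N: "N \<in> maximal_nested_sets L B" and X: "X \<in> N" and i: "i \<in> own N X"
  shows "cl (insert i (under N X)) = X"
proof
  let ?J = "cl (insert i (under N X))"
  have nN: "nested_set L B N" using N by (simp add: maximal_nested_iff)
  have XB: "X \<in> B" using X nested_subset_B[OF nN] by blast
  show JX: "?J \<subseteq> X"
    using i under_subset[of N X] own_subset[of N X] by (intro cl_least B_flat[OF XB]) blast
  have J: "?J \<in> L"
    using i under_subset[of N X] own_subset[of N X] B_subset_ground[OF XB]
    by (intro cl_flat) blast
  have "i \<in> ?J" using subset_cl[of "insert i (under N X)"] by blast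
  then obtain Y where Y: "Y \<in> comps ?J" "i \<in> Y" using Union_comps[OF J] by blast
  have "nested_set L B (insert Y N)" using nested_insert[OF nN X i Y] .
  then have "Y \<in> N" using N by (auto simp: maximal_nested_iff)
  moreover have YJ: "Y \<subseteq> ?J" using Y comps_in_B by blast
  moreover have "\<not> Y \<subset> X" using Y(2) i \<open>Y \<in> N\<close> by (auto simp: own_def under_def)
  ultimately show "X \<subseteq> ?J" using JX by blast
qed

text \<open>A member \<open>Z\<close> that could still be added would, together with the members of \<open>N\<close> strictly
  below the least \<open>X \<in> N\<close> above it, cover \<open>X\<close>; but the components of such a union are
  proper subsets of \<open>X\<close>, while \<open>X\<close> is its own only component.\<close>

lemma maximal_nested_if_cover:
  assumes N: "nested_set L B N"
    and cover: "\<And>X i. X \<in> N \<Longrightarrow> i \<in> own N X \<Longrightarrow> X \<subseteq> cl (insert i (under N X))"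
  shows "N \<in> maximal_nested_sets L B"
  unfolding maximal_nested_iff
proof (intro conjI allI impI N)
  fix N' assume N': "nested_set L B N'" and NN': "N \<subseteq> N'"
  have "Z \<in> N" if Z: "Z \<in> N'" for Z
  proof (rule ccontr)
    assume ZN: "Z \<notin> N"
    have ZB: "Z \<in> B" using Z nested_subset_B[OF N'] by blast
    obtain Z' where "Z' \<in> maximal_elems B" "Z \<subseteq> Z'" using ex_max_above[OF ZB] by blast
    then have "Z' \<in> N" using N by (auto simp: nested_set_def)
    then obtain X where X: "X \<in> N" "Z \<subseteq> X" "\<forall>Y\<in>N. Z \<subseteq> Y \<longrightarrow> X \<subseteq> Y"
      using nested_least_above[OF N B_nonempty[OF ZB]] \<open>Z \<subseteq> Z'\<close> by blast
    obtain i where i: "i \<in> own N' Z" using own_nonempty[OF N' Z] by blast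
    then have iZ: "i \<in> Z" by (rule own_memD)
    have "i \<notin> Y" if "Y \<in> N" "Y \<subset> X" for Y
      using own_member_iff[OF N' Z i, of Y] that NN' X(3) by blast
    then have iX: "i \<in> own N X" using iZ X(2) by (auto simp: own_def under_def)
    let ?T = "insert Z {Y \<in> N. Y \<subset> X}"
    have TN: "?T \<subseteq> N'" using Z NN' by blast
    have UT: "\<Union>?T = Z \<union> under N X" by (auto simp: under_def)
    have "insert i (under N X) \<subseteq> \<Union>?T" using iZ UT by blast
    then have "cl (insert i (under N X)) \<subseteq> \<Union>?T"
      by (rule cl_least[OF nested_Union_flat[OF N' TN]])
    then have "X \<subseteq> \<Union>?T" using cover[OF X(1) iX] by (rule subset_trans[rotated])
    then have "\<Union>?T = X" using UT X(2) under_subset[of N X] by blast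
    then have "X \<in> maximal_elems ?T"
      using nested_Union_comps[OF N' TN] self_comp[of X] X(1) nested_subset_B[OF N] by auto
    then have "X = Z" by (auto simp: maximal_elems_def)
    then show False using X(1) ZN by blast
  qed
  then show "N = N'" using NN' by blast
qed

text \<open>Crossing a codimension one face: the member \<open>X\<close> can be traded for another one such that a
  prescribed element \<open>m\<close> of the block of the parent moves to the block of the new member. Write
  \<open>G\<close> for the part strictly below \<open>P\<close> once \<open>X\<close> is gone. There are exactly two rank steps from \<open>G\<close>
  to \<open>P\<close>; the old chain of flats passes through \<open>X \<union> G\<close>, and the new one through the closure of
  \<open>G\<close> and \<open>m\<close>. Maximality of the new nested set follows from the covering criterion, checked
  separately at the new member, at \<open>P\<close> and elsewhere.\<close>

lemma nested_exchange:
  assumes N: "N \<in> maximal_nested_sets L B" and X: "X \<in> N" and p: "parent N X P"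
    and m: "m \<in> own N P"
  shows "\<exists>X'. X' \<notin> N \<and> insert X' (N - {X}) \<in> maximal_nested_sets L B \<and>
    parent (insert X' (N - {X})) X' P \<and> m \<in> own (insert X' (N - {X})) X' \<and>
    own (insert X' (N - {X})) P \<union> own (insert X' (N - {X})) X' = own N P \<union> own N X"
proof -
  let ?R = "N - {X}"
  define G where "G = under ?R P"
  let ?J = "cl (insert m G)"
  have nN: "nested_set L B N" using N by (simp add: maximal_nested_iff)
  have R: "nested_set L B ?R" using nested_remove[OF nN p] .
  have P: "P \<in> N" "P \<in> ?R" "X \<subset> P" using p by (auto simp: parent_def)
  have PB: "P \<in> B" and XB: "X \<in> B" using P(1) X nested_subset_B[OF nN] by blast+
  have uP: "under N P = X \<union> G" and uX: "under N X = X \<inter> G"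
    using under_parent[OF p X] under_child[OF nN p X] by (simp_all add: G_def)
  have G: "G \<in> L" unfolding G_def using under_flat[OF R] .
  have GP: "G \<subseteq> P" unfolding G_def by (rule under_subset)
  have PE: "P \<subseteq> E" using B_subset_ground[OF PB] .
  have mP: "m \<in> P" "m \<notin> X" "m \<notin> G" using m by (auto simp: own_def uP)
  have mR: "m \<in> own ?R P" using own_merge[OF nN p X] m by blast
  have J: "?J \<in> L" using GP PE mP by (intro cl_flat) blast
  have GJ: "insert m G \<subseteq> ?J" by (rule subset_cl)
  have JP: "?J \<subseteq> P" using GP mP by (intro cl_least B_flat[OF PB]) blast
  have "m \<in> \<Union>(comps ?J)" unfolding Union_comps[OF J] using GJ by blast
  then obtain X' where X': "X' \<in> comps ?J" "m \<in> X'" by blast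
  have X'J: "X' \<subseteq> ?J" and X'B: "X' \<in> B" using X' comps_in_B by blast+
  let ?N = "insert X' ?R"
  have nN': "nested_set L B ?N" using nested_insert[OF R P(2) mR X'[unfolded G_def]] .
  obtain j where j: "j \<in> own N X" using own_nonempty[OF nN X] by blast
  have jX: "j \<in> X" "j \<notin> G" using j by (auto simp: own_def uX)
  have uPL: "under N P \<in> L" using under_flat[OF nN] .
  \<comment> \<open>Otherwise exchange would put \<open>m\<close> into the closure of \<open>G\<close> and \<open>j\<close>, which lies below \<open>P\<close>.\<close>
  have jJ: "j \<notin> ?J"
  proof
    assume "j \<in> ?J"
    then have "m \<in> cl (insert j G)" using cl_exchange[OF G] jX PE mP(1) by blast
    also have "cl (insert j G) \<subseteq> under N P" using jX uP by (intro cl_least uPL) blast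
    finally show False using m by (simp add: own_def)
  qed
  have X'P: "X' \<subset> P" using X'J JP jJ jX P(3) by blast
  have X'R: "X' \<notin> ?R"
  proof
    assume "X' \<in> ?R"
    then have "X' \<subseteq> G" using X'P by (auto simp: G_def under_def)
    then show False using X'(2) mP by blast
  qed
  have X'N: "X' \<notin> N" using X'R X'(2) mP by blast
  have R_eq: "?N - {X'} = ?R" using X'R by blast
  have p': "parent ?N X' P"
    unfolding parent_def
  proof (intro conjI ballI impI X'P)
    fix Y assume Y: "Y \<in> ?N" "X' \<subset> Y"
    then have "Y \<in> ?R" "m \<in> Y" using X'(2) by auto
    then have "P \<subseteq> Y \<or> Y \<subset> P" using nested_cases[OF R P(2), of Y m] mP(1) by blast
    moreover have "\<not> Y \<subset> P" using \<open>Y \<in> ?R\<close> \<open>m \<in> Y\<close> mP(3) by (auto simp: G_def under_def)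
    ultimately show "P \<subseteq> Y" by blast
  qed (use P in auto)
  have X'in: "X' \<in> ?N" by simp
  have uP': "under ?N P = X' \<union> G"
    using under_parent[OF p' X'in] unfolding R_eq G_def .
  have uX': "under ?N X' = X' \<inter> G"
    using under_child[OF nN' p' X'in] unfolding R_eq G_def .
  have "own ?N P \<union> own ?N X' = own N P \<union> own N X"
    using own_merge[OF nN' p' X'in] own_merge[OF nN p X] unfolding R_eq by simp
  moreover have "m \<in> own ?N X'" using X'(2) mP(3) by (simp add: own_def uX')
  moreover have "?N \<in> maximal_nested_sets L B"
  proof (rule maximal_nested_if_cover[OF nN'])
    fix Y i assume Y: "Y \<in> ?N" and i: "i \<in> own ?N Y"
    consider "Y = X'" | "Y = P" | "Y \<in> ?R" "Y \<noteq> P" using Y by blast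
    then show "Y \<subseteq> cl (insert i (under ?N Y))"
    proof cases
      case 1
      let ?K = "cl (insert i (under ?N X'))"
      have iX': "i \<in> X'" "i \<notin> G" using i 1 by (auto simp: own_def uX')
      have iu: "insert i (under ?N X') \<subseteq> X'" using iX' uX' by blast
      have K: "?K \<in> L" "?K \<subseteq> X'"
        using iu B_subset_ground[OF X'B] cl_least[OF B_flat[OF X'B] iu] cl_flat by blast+
      have K_ge: "insert i (X' \<inter> G) \<subseteq> ?K" using subset_cl uX' by metis
      \<comment> \<open>If \<open>?K\<close> were smaller than \<open>X'\<close>, replacing \<open>X'\<close> by \<open>?K\<close> would shrink the join \<open>?J\<close>.\<close>
      define z where "z W = (if W = X' then ?K else W)" for W
      have "insert i G \<subseteq> (\<Union>W\<in>comps ?J. z W)"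
      proof
        fix g assume g: "g \<in> insert i G"
        show "g \<in> (\<Union>W\<in>comps ?J. z W)"
        proof (cases "g \<in> X'")
          case True
          then have "g \<in> z X'" using g K_ge by (auto simp: z_def)
          then show ?thesis using X'(1) by blast
        next
          case False
          then have "g \<in> ?J" using g iX' GJ by blast
          then obtain W where W: "W \<in> comps ?J" "g \<in> W" using Union_comps[OF J] by blast
          then have "g \<in> z W" using False by (auto simp: z_def)
          then show ?thesis using W by blast
        qed
      qed
      then have le: "cl (insert i G) \<subseteq> cl (\<Union>W\<in>comps ?J. z W)" by (rule cl_mono)
      have mE: "m \<in> E" using mP PE by blast
      have "m \<in> cl (insert i G)" using cl_exchange[OF G mE _ iX'(2)] iX'(1) X'J by blast
      then have "insert m G \<subseteq> cl (insert i G)" using subset_cl[of "insert i G"] by blast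
      then have "?J \<subseteq> cl (insert i G)"
        using iX' X'P PE GP by (intro cl_least cl_flat) auto
      then have "?J \<subseteq> cl (\<Union>W\<in>comps ?J. z W)" using le by blast
      then have "z X' = X'"
        using K comps_in_B B_flat by (intro comps_tight[OF J _ _ X'(1)]) (auto simp: z_def)
      then show ?thesis using 1 by (simp add: z_def)
    next
      case 2
      have "X' \<union> G \<in> L" using under_flat[OF nN', of P] uP' by simp
      then have "?J \<subseteq> X' \<union> G" using X'(2) by (intro cl_least) auto
      then have uJ: "under ?N P = ?J" using uP' X'J GJ by blast
      have iJ: "i \<in> P" "i \<notin> ?J" using i 2 by (auto simp: own_def uJ)
      have jE: "j \<in> E" and iE: "i \<in> E" using jX(1) P(3) PE iJ by blast+
      have top: "P \<subseteq> cl (insert j ?J)"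
      proof -
        have cL: "cl (insert j ?J) \<in> L" using jE JP PE by (intro cl_flat) blast
        have c: "insert j ?J \<subseteq> cl (insert j ?J)" by (rule subset_cl)
        have "insert j (under N X) \<subseteq> cl (insert j ?J)" using c GJ uX by blast
        then have "X \<subseteq> cl (insert j ?J)"
          using maximal_nested_cover[OF N X j] cl_least[OF cL] by metis
        then have "insert m (under N P) \<subseteq> cl (insert j ?J)" using c GJ uP by blast
        then show ?thesis
          using maximal_nested_cover[OF N P(1) m] cl_least[OF cL] by metis
      qed
      then have "j \<in> cl (insert i ?J)" using cl_exchange[OF J jE _ iJ(2)] iJ(1) by blast
      then have "insert j ?J \<subseteq> cl (insert i ?J)" using subset_cl[of "insert i ?J"] by blast
      then have "cl (insert j ?J) \<subseteq> cl (insert i ?J)"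
        using iE JP PE by (intro cl_least cl_flat) auto
      then show ?thesis using top 2 uJ by auto
    next
      case 3
      have "under ?N Y = under ?R Y" using under_remove_other[OF p' Y 3(2)] R_eq by simp
      moreover have "under N Y = under ?R Y" using under_remove_other[OF p _ 3(2)] 3(1) by blast
      ultimately have u: "under ?N Y = under N Y" by simp
      then have "i \<in> own N Y" using i by (simp add: own_def)
      then show ?thesis using maximal_nested_cover[OF N] 3(1) u by simp
    qed
  qed
  ultimately show ?thesis using X'N p' by blast
qed

section \<open>Vectors spanned by a nested set\<close>

lemma sum_Union_zero:
  fixes d :: "'e \<Rightarrow> real"
  assumes N: "nested_set L B N" and T: "T \<subseteq> N" and zero: "\<And>Y. Y \<in> T \<Longrightarrow> sum d Y = 0"
  shows "sum d (\<Union>T) = 0"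
proof -
  let ?C = "comps (\<Union>T)"
  have f: "\<Union>T \<in> L" and c: "?C = maximal_elems T" using nested_Union[OF N T] .
  have CT: "?C \<subseteq> T" by (auto simp: c maximal_elems_def)
  have "sum d (\<Union>?C) = (sum \<circ> sum) d ?C"
  proof (rule sum.Union_disjoint)
    show "\<forall>A\<in>?C. finite A"
      using comps_in_B B_subset_ground finite_ground finite_subset by metis
    show "\<forall>A\<in>?C. \<forall>A'\<in>?C. A \<noteq> A' \<longrightarrow> A \<inter> A' = {}" using comps_disjoint[OF f] by blast
  qed
  also have "\<dots> = 0"
    unfolding comp_def by (rule sum.neutral, rule ballI, rule zero, rule subsetD[OF CT])
  finally show ?thesis using Union_comps[OF f] by simp
qed

text \<open>Here \<open>d\<close> is a vector in the span of the nested set and orthogonal to all members except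
  \<open>X\<close>. It is constant on blocks. Subtracting the orthogonality relations of the members strictly
  below, its sum vanishes on every block other than those of \<open>X\<close> and \<open>P\<close>, and on the union of
  these two. The coefficient \<open>c X\<close> is the difference of the values on these two blocks, which
  determines their signs.\<close>

lemma edge_direction:
  fixes c :: "'e set \<Rightarrow> real" and d :: "'e \<Rightarrow> real"
  assumes N: "nested_set L B N" and X: "X \<in> N" and p: "parent N X P" and pos: "c X > 0"
    and d: "\<And>i. d i = sum c {Y \<in> N. i \<in> Y}"
    and orth: "\<And>Y. Y \<in> N - {X} \<Longrightarrow> sum d Y = 0"
  shows "i \<in> own N X \<Longrightarrow> d i > 0" and "i \<in> own N P \<Longrightarrow> d i < 0"
    and "i \<notin> own N X \<Longrightarrow> i \<notin> own N P \<Longrightarrow> d i = 0"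
proof -
  let ?R = "N - {X}"
  define val where "val Y = sum c {Z \<in> N. Y \<subseteq> Z}" for Y
  have P: "P \<in> N" "X \<subset> P" using p by (auto simp: parent_def)
  have finN: "finite N" using nested_finite[OF N] .
  have fin: "finite Y" if "Y \<in> N" for Y
    using that nested_subset_B[OF N] B_subset_ground finite_ground finite_subset by blast
  have dval: "d i = val Y" if Y: "Y \<in> N" "i \<in> own N Y" for Y i
  proof -
    have "{Z \<in> N. i \<in> Z} = {Z \<in> N. Y \<subseteq> Z}" using own_member_iff[OF N Y] by blast
    then show ?thesis by (simp add: d val_def)
  qed
  have sum_own: "sum d (own N Y) = card (own N Y) * val Y" if Y: "Y \<in> N" for Y
    using dval[OF Y] by simp
  have finown: "finite (own N Y)" if "Y \<in> N" for Y
    using fin[OF that] by (simp add: own_def)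
  have card_pos: "card (own N Y) > 0" if Y: "Y \<in> N" for Y
    using own_nonempty[OF N Y] finown[OF Y] by (simp add: card_gt_0_iff)
  have R: "nested_set L B ?R" using nested_remove[OF N p] .
  have sum_under: "sum d (under ?R Y) = 0" for Y
    unfolding under_def by (rule sum_Union_zero[OF R]) (use orth in auto)
  have own_zero: "sum d (own ?R Y) = 0" if Y: "Y \<in> ?R" for Y
  proof -
    have "sum d (own ?R Y) = sum d Y - sum d (under ?R Y)"
      unfolding own_def using fin Y under_subset by (intro sum_diff) auto
    then show ?thesis using orth[OF Y] sum_under by simp
  qed
  have val0: "val Y = 0" if Y: "Y \<in> ?R" "Y \<noteq> P" for Y
  proof -
    have YN: "Y \<in> N" using Y(1) by blast
    have "own N Y = own ?R Y" using under_remove_other[OF p YN Y(2)] by (simp add: own_def)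
    then show ?thesis using own_zero[OF Y(1)] sum_own[OF YN] card_pos[OF YN] by simp
  qed
  have "own N P \<inter> own N X = {}" using own_disjoint[OF N P(1) _ X] P(2) by blast
  then have "sum d (own N P \<union> own N X) = sum d (own N P) + sum d (own N X)"
    using finown P(1) X by (intro sum.union_disjoint) auto
  then have balance: "card (own N P) * val P + card (own N X) * val X = 0"
    using own_merge[OF N p X] own_zero[of P] P sum_own[OF P(1)] sum_own[OF X] by simp
  have "{Z \<in> N. X \<subseteq> Z} = insert X {Z \<in> N. P \<subseteq> Z}" using p X by (auto simp: parent_def)
  moreover have "X \<notin> {Z \<in> N. P \<subseteq> Z}" using P(2) by blast
  ultimately have jump: "val X = c X + val P" using finN by (simp add: val_def)
  have cards: "real (card (own N P)) > 0" "real (card (own N X)) > 0"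
    using card_pos P(1) X by auto
  have valX: "val X > 0"
  proof (rule ccontr)
    assume "\<not> val X > 0"
    then have "val P < 0" "val X \<le> 0" using jump pos by auto
    then have "card (own N P) * val P < 0" "card (own N X) * val X \<le> 0"
      using cards by (simp_all add: mult_pos_neg mult_nonneg_nonpos)
    then show False using balance by linarith
  qed
  have valP: "val P < 0"
  proof (rule ccontr)
    assume "\<not> val P < 0"
    then have "card (own N P) * val P \<ge> 0" "card (own N X) * val X > 0"
      using cards valX by simp_all
    then show False using balance by linarith
  qed
  show "i \<in> own N X \<Longrightarrow> d i > 0" using dval[OF X] valX by simp
  show "i \<in> own N P \<Longrightarrow> d i < 0" using dval[OF P(1)] valP by simp
  assume i: "i \<notin> own N X" "i \<notin> own N P"
  show "d i = 0"
  proof (cases "\<exists>Z\<in>N. i \<in> Z")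
    case True
    then obtain Y where Y: "Y \<in> N" "i \<in> own N Y" using ex_owner[OF N] by blast
    then have "Y \<in> ?R" "Y \<noteq> P" using i by auto
    then show ?thesis using dval[OF Y] val0 by simp
  next
    case False
    then have none: "{Z \<in> N. i \<in> Z} = {}" by blast
    show ?thesis unfolding d none by simp
  qed
qed

text \<open>The members containing \<open>j\<close> but not \<open>i\<close> are proper subsets of \<open>Y\<close>. They are thus not maximal
  in \<open>B\<close>, and their coefficients are positive.\<close>

lemma own_value_least:
  fixes v :: "'e \<Rightarrow> real"
  assumes N: "nested_set L B N" and pos: "\<And>Y. Y \<in> N - maximal_elems B \<Longrightarrow> a Y > 0"
    and v: "\<And>i. v i = sum a {Y \<in> N. i \<in> Y}"
    and Y: "Y \<in> N" "i \<in> own N Y" and j: "j \<in> Y"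
  shows "v i \<le> v j"
  unfolding v
proof (rule sum_mono2)
  show "finite {Y \<in> N. j \<in> Y}" using nested_finite[OF N] by simp
  show "{Y \<in> N. i \<in> Y} \<subseteq> {Y \<in> N. j \<in> Y}" using own_member_iff[OF N Y] j by blast
  fix Z assume "Z \<in> {Y \<in> N. j \<in> Y} - {Y \<in> N. i \<in> Y}"
  then have Z: "Z \<in> N" "j \<in> Z" "i \<notin> Z" by auto
  then have "\<not> Y \<subseteq> Z" using own_member_iff[OF N Y] by blast
  then have "Z \<subset> Y" using nested_cases[OF N Y(1) Z(1) j Z(2)] by blast
  then have "Z \<notin> maximal_elems B"
    using Y(1) nested_subset_B[OF N] by (auto simp: maximal_elems_def)
  then show "0 \<le> a Z" using pos Z(1) by (simp add: less_imp_le)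
qed

text \<open>The values on the blocks increase away from the root, so every point of a superlevel set
  comes with its smallest enclosing member of \<open>N\<close>. The superlevel set is thus a union of members
  of \<open>N\<close>, and the components of such unions are known.\<close>

lemma superlevel_comps:
  fixes v :: "'e \<Rightarrow> real"
  assumes N: "nested_set L B N" and pos: "\<And>Y. Y \<in> N - maximal_elems B \<Longrightarrow> a Y > 0"
    and v: "\<And>i. v i = sum a {Y \<in> N. i \<in> Y}" and M: "M \<in> maximal_elems B"
  shows "comps {i \<in> M. v i \<ge> t} = maximal_elems {Z \<in> N. Z \<subseteq> {i \<in> M. v i \<ge> t}}"
proof -
  let ?F = "{i \<in> M. v i \<ge> t}"
  have MN: "M \<in> N" using M N by (auto simp: nested_set_def)
  have "\<exists>Z\<in>N. Z \<subseteq> ?F \<and> i \<in> Z" if i: "i \<in> ?F" for i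
  proof -
    obtain Y where Y: "Y \<in> N" "Y \<subseteq> M" "i \<in> own N Y" using ex_owner[OF N MN] i by blast
    have "v i \<le> v j" if "j \<in> Y" for j using own_value_least[OF N pos v Y(1,3) that] .
    then have "Y \<subseteq> ?F" using Y(2) i by fastforce
    then show ?thesis using Y(1) own_memD[OF Y(3)] by blast
  qed
  then have "\<Union>{Z \<in> N. Z \<subseteq> ?F} = ?F" by blast
  then show ?thesis using nested_Union_comps[OF N, of "{Z \<in> N. Z \<subseteq> ?F}"] by auto
qed

text \<open>Distinct cones have disjoint interiors. A member \<open>X\<close> that is not maximal in \<open>B\<close> has
  strictly larger value on its block than all members properly containing it, so it is a
  component of the superlevel set at that value. Components of superlevel sets do not depend on
  the nested set used to represent the vector.\<close>

lemma interior_determines_nested_set: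
  fixes v :: "'e \<Rightarrow> real"
  assumes N: "nested_set L B N" and pos: "\<And>Y. Y \<in> N - maximal_elems B \<Longrightarrow> a Y > 0"
    and v: "\<And>i. v i = sum a {Y \<in> N. i \<in> Y}"
    and N': "nested_set L B N'" and pos': "\<And>Y. Y \<in> N' - maximal_elems B \<Longrightarrow> a' Y > 0"
    and v': "\<And>i. v i = sum a' {Y \<in> N'. i \<in> Y}"
  shows "N \<subseteq> N'"
proof
  fix X assume X: "X \<in> N"
  show "X \<in> N'"
  proof (cases "X \<in> maximal_elems B")
    case True
    then show ?thesis using N' by (auto simp: nested_set_def)
  next
    case False
    obtain M where M: "M \<in> maximal_elems B" "X \<subseteq> M"
      using ex_max_above X nested_subset_B[OF N] by blast
    obtain x where x: "x \<in> own N X" using own_nonempty[OF N X] by blast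
    let ?F = "{i \<in> M. v i \<ge> v x}"
    have aX: "a X > 0" using pos X False by blast
    have fin: "finite {Y \<in> N. i \<in> Y}" for i using nested_finite[OF N] by simp
    have "v x \<le> v j" if "j \<in> X" for j using own_value_least[OF N pos v X x that] .
    then have XF: "X \<subseteq> ?F" using M(2) by blast
    have "X = Z" if Z: "Z \<in> N" "Z \<subseteq> ?F" "X \<subseteq> Z" for Z
    proof (rule ccontr)
      assume "X \<noteq> Z"
      then have XZ: "X \<subset> Z" using Z(3) by blast
      obtain z where z: "z \<in> own N Z" using own_nonempty[OF N Z(1)] by blast
      \<comment> \<open>On the way down from the block of \<open>Z\<close> to that of \<open>X\<close> at least \<open>a X\<close> is gained.\<close>
      have "v z + a X = sum a (insert X {Y \<in> N. z \<in> Y})"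
        using fin own_member_iff[OF N Z(1) z X] XZ by (auto simp: v)
      also have "\<dots> \<le> sum a {Y \<in> N. x \<in> Y}"
      proof (rule sum_mono2[OF fin])
        show "insert X {Y \<in> N. z \<in> Y} \<subseteq> {Y \<in> N. x \<in> Y}"
          using own_member_iff[OF N Z(1) z] own_memD[OF x] X XZ by blast
        fix Y assume "Y \<in> {Y \<in> N. x \<in> Y} - insert X {Y \<in> N. z \<in> Y}"
        then have Y: "Y \<in> N" "x \<in> Y" "z \<notin> Y" by auto
        then have "\<not> Z \<subseteq> Y" using own_member_iff[OF N Z(1) z] by blast
        moreover have "x \<in> Z" using own_memD[OF x] XZ by blast
        ultimately have "Y \<subset> Z" using nested_cases[OF N Z(1) Y(1) _ Y(2)] by blast
        then have "Y \<notin> maximal_elems B"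
          using Z(1) nested_subset_B[OF N] by (auto simp: maximal_elems_def)
        then show "0 \<le> a Y" using pos Y(1) by (simp add: less_imp_le)
      qed
      finally have "v z < v x" using aX by (simp add: v)
      then show False using own_memD[OF z] Z(2) by fastforce
    qed
    then have "X \<in> maximal_elems {Z \<in> N. Z \<subseteq> ?F}" using X XF by (simp add: maximal_elems_iff)
    also have "\<dots> = comps ?F" using superlevel_comps[OF N pos v M(1)] by blast
    also have "\<dots> = maximal_elems {Z \<in> N'. Z \<subseteq> ?F}"
      using superlevel_comps[OF N' pos' v' M(1)] by blast
    finally show ?thesis by (simp add: maximal_elems_def)
  qed
qed

end

section \<open>Cones and their relative interiors\<close>

lemma e_vec_component: "e_vec X $ i = (if i \<in> X then 1 else 0)"
  by (simp add: e_vec_def axis_def)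

lemma inner_e_vec: "v \<bullet> e_vec X = sum (($) v) X"
  by (simp add: inner_vec_def e_vec_component if_distrib sum.If_cases)

lemma sum_e_vec_component:
  fixes N :: "'e::finite set set"
  shows "(\<Sum>Y\<in>N. a Y *\<^sub>R e_vec Y) $ i = sum a {Y \<in> N. i \<in> Y}"
proof -
  have "(\<Sum>Y\<in>N. a Y *\<^sub>R e_vec Y) $ i = (\<Sum>Y\<in>N. if i \<in> Y then a Y else 0)"
    by (simp add: e_vec_component if_distrib cong: if_cong)
  then show ?thesis by (simp add: sum.inter_filter)
qed

lemma nested_cone_coefficients:
  fixes N :: "'e::finite set set"
  assumes M: "maximal_elems B \<subseteq> N" and w: "w \<in> nested_cone B N"
  shows "\<exists>a. (\<forall>Y\<in>N - maximal_elems B. a Y \<ge> 0) \<and> w = (\<Sum>Y\<in>N. a Y *\<^sub>R e_vec Y)"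
proof -
  let ?M = "maximal_elems B"
  let ?h = "\<lambda>w. \<exists>a. (\<forall>Y\<in>N - ?M. a Y \<ge> 0) \<and> w = (\<Sum>Y\<in>N. a Y *\<^sub>R e_vec Y)"
  have add: "?h (x + y)" if "?h x" "?h y" for x y
  proof -
    obtain a where "\<forall>Y\<in>N - ?M. a Y \<ge> 0" "x = (\<Sum>Y\<in>N. a Y *\<^sub>R e_vec Y)"
      using \<open>?h x\<close> by (elim exE conjE)
    moreover obtain b where "\<forall>Y\<in>N - ?M. b Y \<ge> 0" "y = (\<Sum>Y\<in>N. b Y *\<^sub>R e_vec Y)"
      using \<open>?h y\<close> by (elim exE conjE)
    ultimately show ?thesis
      by (intro exI[of _ "\<lambda>Y. a Y + b Y"]) (simp add: scaleR_left_distrib sum.distrib)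
  qed
  have scale: "?h (r *\<^sub>R x)" if "?h x" "r \<ge> 0" for r x
  proof -
    obtain a where "\<forall>Y\<in>N - ?M. a Y \<ge> 0" "x = (\<Sum>Y\<in>N. a Y *\<^sub>R e_vec Y)"
      using \<open>?h x\<close> by (elim exE conjE)
    then show ?thesis
      using that(2) by (intro exI[of _ "\<lambda>Y. r * a Y"]) (simp add: scaleR_sum_right)
  qed
  have gen: "?h (r *\<^sub>R e_vec X)" if X: "X \<in> N" and r: "X \<in> ?M \<or> r \<ge> 0" for r X
  proof (intro exI[of _ "\<lambda>Y. if Y = X then r else 0"] conjI)
    show "r *\<^sub>R e_vec X = (\<Sum>Y\<in>N. (if Y = X then r else 0) *\<^sub>R e_vec Y)"
      using X by (simp add: if_distrib[of "\<lambda>c. c *\<^sub>R _"] sum.delta cong: if_cong)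
  qed (use r in auto)
  have zero: "?h 0" by (intro exI[of _ "\<lambda>_. 0"]) simp
  have lin: "?h l" if "l \<in> lineality_space B" for l
    using that unfolding lineality_space_def
  proof (rule span_induct_alt)
    fix c x y assume "x \<in> e_vec ` ?M" and y: "?h y"
    then obtain X where X: "X \<in> ?M" "x = e_vec X" by blast
    then have "?h (c *\<^sub>R x)" using gen[of X c] M by blast
    then show "?h (c *\<^sub>R x + y)" using add y by blast
  qed (rule zero)
  have "convex_cone (Collect ?h)"
    unfolding convex_cone_iff using add scale zero by auto
  moreover have "e_vec ` (N - ?M) \<subseteq> Collect ?h"
  proof
    fix x assume "x \<in> e_vec ` (N - ?M)"
    then obtain X where "X \<in> N" "x = e_vec X" by blast
    then show "x \<in> Collect ?h" using gen[of X 1] by simp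
  qed
  ultimately have cone: "convex_cone hull (e_vec ` (N - ?M)) \<subseteq> Collect ?h"
    by (intro hull_minimal)
  obtain l c where "l \<in> lineality_space B" "c \<in> convex_cone hull (e_vec ` (N - ?M))" "w = l + c"
    using w unfolding nested_cone_def by (auto elim: set_plus_elim)
  then show ?thesis using add[of l c] lin cone by blast
qed

text \<open>A point of the relative interior can be moved a little away from the sum of the
  generators without leaving the cone, which makes room for positive coefficients.\<close>

lemma rel_interior_nested_cone_coefficients:
  fixes N :: "'e::finite set set"
  assumes M: "maximal_elems B \<subseteq> N" and v: "v \<in> rel_interior (nested_cone B N)"
  shows "\<exists>a. (\<forall>Y\<in>N - maximal_elems B. a Y > 0) \<and> v = (\<Sum>Y\<in>N. a Y *\<^sub>R e_vec Y)"
proof -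
  let ?M = "maximal_elems B" and ?C = "nested_cone B N"
  let ?K = "convex_cone hull (e_vec ` (N - ?M))"
  define s where "s = (\<Sum>Y\<in>N - ?M. e_vec Y)"
  have "finite S \<Longrightarrow> S \<subseteq> N - ?M \<Longrightarrow> (\<Sum>Y\<in>S. e_vec Y) \<in> ?K" for S
  proof (induction S rule: finite_induct)
    case empty
    show ?case by (simp add: convex_cone_hull_contains_0)
  next
    case (insert Y S)
    then show ?case by (simp add: convex_cone_hull_add hull_inc)
  qed
  then have "s \<in> ?K" by (simp add: s_def)
  moreover have "0 \<in> lineality_space B" by (simp add: lineality_space_def span_zero)
  ultimately have "0 + s \<in> ?C" unfolding nested_cone_def by (intro set_plus_intro)
  then have sC: "s \<in> ?C" by simp
  have "convex ?C"
    unfolding nested_cone_def lineality_space_def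
    by (intro convex_set_plus convex_convex_cone_hull subspace_imp_convex subspace_span)
  then obtain r where r: "r > 1" "(1 - r) *\<^sub>R s + r *\<^sub>R v \<in> ?C"
    using convex_rel_interior_if2[OF _ v] hull_inc[OF sC] by blast
  obtain a where a: "\<forall>Y\<in>N - ?M. a Y \<ge> 0"
    "(1 - r) *\<^sub>R s + r *\<^sub>R v = (\<Sum>Y\<in>N. a Y *\<^sub>R e_vec Y)"
    using nested_cone_coefficients[OF M r(2)] by blast
  let ?b = "\<lambda>Y. (a Y + (if Y \<in> ?M then 0 else r - 1)) / r"
  have s_eq: "(r - 1) *\<^sub>R s = (\<Sum>Y\<in>N. (if Y \<in> ?M then 0 else r - 1) *\<^sub>R e_vec Y)"
  proof -
    have "(\<Sum>Y\<in>N. (if Y \<in> ?M then 0 else r - 1) *\<^sub>R e_vec Y :: real ^ 'e) =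
      (\<Sum>Y\<in>N - ?M. (if Y \<in> ?M then 0 else r - 1) *\<^sub>R e_vec Y)"
      by (rule sum.mono_neutral_right) auto
    also have "\<dots> = (r - 1) *\<^sub>R s" unfolding s_def scaleR_sum_right by (rule sum.cong) auto
    finally show ?thesis by simp
  qed
  have "r *\<^sub>R v = ((1 - r) *\<^sub>R s + r *\<^sub>R v) + (r - 1) *\<^sub>R s" by (simp add: algebra_simps)
  also have "\<dots> = (\<Sum>Y\<in>N. (a Y + (if Y \<in> ?M then 0 else r - 1)) *\<^sub>R e_vec Y)"
    unfolding a(2) s_eq by (simp only: scaleR_left_distrib sum.distrib)
  also have "\<dots> = r *\<^sub>R (\<Sum>Y\<in>N. ?b Y *\<^sub>R e_vec Y)"
    using r(1) by (simp add: scaleR_sum_right)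
  finally have "v = (\<Sum>Y\<in>N. ?b Y *\<^sub>R e_vec Y)" using r(1) by simp
  moreover have "\<forall>Y\<in>N - ?M. ?b Y > 0" using a(1) r(1) by (auto intro!: divide_pos_pos add_nonneg_pos)
  ultimately show ?thesis by (intro exI[of _ ?b] conjI)
qed


section \<open>Ascents and the lexicographic order of the vertices\<close>

locale cubical_matroid = built_matroid E indep B
  for E :: "'e::{finite,linorder} set" and indep :: "'e set \<Rightarrow> bool" and B :: "'e set set" +
  fixes \<phi> :: "(real, 'e) vec \<Rightarrow> real"
  assumes cubical_fun: "cubical E (flats E indep) B \<phi>"
begin

text \<open>Write \<open>P\<close> for the parent of \<open>X\<close>. Moving from the vertex of \<open>N - {X}\<close> to the vertex of \<open>N\<close>
  increases the coordinates in the block of \<open>X\<close> and decreases those in the block of \<open>P\<close>. Which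
  change the lexicographic order sees first depends on which of the two blocks contains the
  smaller minimum. Roots have no parent and count as ascents.\<close>

definition ascent :: "'e set set \<Rightarrow> 'e set \<Rightarrow> bool" where
  "ascent N X \<longleftrightarrow> (\<forall>P. parent N X P \<longrightarrow> Min (own N X) < Min (own N P))"

abbreviation vert :: "'e set set \<Rightarrow> (real, 'e) vec" where
  "vert N \<equiv> vertex E B \<phi> N"

lemma Min_own_in: "nested_set L B N \<Longrightarrow> X \<in> N \<Longrightarrow> Min (own N X) \<in> own N X"
  using own_nonempty by (intro Min_in) auto

text \<open>Along ascents the block minima decrease from the root to the leaves. So the member \<open>X\<close> of
  \<open>N\<close> whose block contains the minimum \<open>m\<close> of a block of \<open>R\<close> has only members of \<open>R\<close> directly
  below it. This pins \<open>X\<close> down in terms of \<open>R\<close> alone, as the component that contains \<open>m\<close>.\<close>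

lemma least_element_component:
  assumes N: "N \<in> maximal_nested_sets L B" and R: "nested_set L B R" "R \<subseteq> N" and P: "P \<in> R"
    and asc: "\<And>Y. Y \<in> N - R \<Longrightarrow> ascent N Y"
  defines "m \<equiv> Min (own R P)"
  shows "\<exists>X\<in>N. X \<subseteq> P \<and> m \<in> X \<and> X \<in> comps (cl (insert m (under R P))) \<and>
    (\<forall>Y\<in>N. Y \<subset> X \<longrightarrow> Y \<subseteq> under R P)"
proof -
  let ?G = "under R P"
  have nN: "nested_set L B N" using N by (simp add: maximal_nested_iff)
  have PN: "P \<in> N" using P R(2) by blast
  have m: "m \<in> own R P" unfolding m_def using Min_own_in[OF R(1) P] .
  obtain X where X: "X \<in> N" "X \<subseteq> P" "m \<in> own N X" using ex_owner[OF nN PN own_memD[OF m]] by blast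
  have mX: "m \<in> X" using own_memD[OF X(3)] .
  have mG: "m \<notin> ?G" using m by (simp add: own_def)
  have below: "Y \<subseteq> ?G" if Y: "Y \<in> N" "Y \<subset> X" for Y
  proof -
    have "finite {Z \<in> N. Z \<subset> X}" using nested_finite[OF nN] by simp
    then obtain Z where Z: "Z \<in> maximal_elems {Z \<in> N. Z \<subset> X}" "Y \<subseteq> Z"
      using ex_maximal_above Y by blast
    then have ZN: "Z \<in> N" "Z \<subset> X" and Zmax: "\<And>W. W \<in> N \<Longrightarrow> W \<subset> X \<Longrightarrow> Z \<subseteq> W \<Longrightarrow> Z = W"
      by (auto simp: maximal_elems_iff)
    have "Z \<in> R"
    proof (rule ccontr)
      assume ZR: "Z \<notin> R"
      define j where "j = Min (own N Z)"
      have j: "j \<in> own N Z" unfolding j_def using Min_own_in[OF nN ZN(1)] .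
      have jZ: "j \<in> Z" using own_memD[OF j] .
      have "parent N Z X"
        unfolding parent_def
      proof (intro conjI ballI impI X(1) ZN(2))
        fix W assume W: "W \<in> N" "Z \<subset> W"
        then have "X \<subseteq> W \<or> W \<subset> X" using nested_cases[OF nN X(1) W(1), of j] jZ ZN(2) by blast
        then show "X \<subseteq> W" using Zmax W by blast
      qed
      then have "j < Min (own N X)" using asc[of Z] ZN ZR by (auto simp: ascent_def j_def)
      also have "\<dots> \<le> m" using X(3) by simp
      finally have "j \<notin> own R P" by (metis Min_le finite linorder_not_le m_def)
      then have "j \<in> ?G" using jZ ZN(2) X(2) by (auto simp: own_def)
      then obtain C where C: "C \<in> R" "C \<subset> P" "j \<in> C" by (auto simp: under_def)
      have CN: "C \<in> N" using C R(2) by blast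
      have "Z \<subseteq> C" using own_member_iff[OF nN ZN(1) j CN] C(3) by blast
      have "m \<notin> C" using mG C by (auto simp: under_def)
      then have "\<not> X \<subseteq> C" using mX by blast
      then have "C \<subset> X" using nested_cases[OF nN X(1) CN, of j] jZ ZN(2) C(3) by blast
      then have "Z = C" using Zmax[OF CN] \<open>Z \<subseteq> C\<close> by blast
      then show False using C(1) ZR by blast
    qed
    moreover have "Z \<subset> P" using ZN(2) X(2) by blast
    ultimately have "Z \<subseteq> ?G" by (auto simp: under_def)
    then show ?thesis using Z(2) by blast
  qed
  let ?J = "cl (insert m ?G)"
  have GJ: "insert m ?G \<subseteq> ?J" by (rule subset_cl)
  have "under N X \<subseteq> ?G" using below by (auto simp: under_def)
  then have "cl (insert m (under N X)) \<subseteq> ?J" by (intro cl_mono) blast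
  then have XJ: "X \<subseteq> ?J" using maximal_nested_cover[OF N X(1,3)] by simp
  let ?T = "insert X {Y \<in> R. Y \<subset> P}"
  have TN: "?T \<subseteq> N" using X(1) R(2) by blast
  have UT: "\<Union>?T = X \<union> ?G" by (auto simp: under_def)
  have "?J \<subseteq> \<Union>?T"
    using mX UT by (intro cl_least[OF nested_Union_flat[OF nN TN]]) auto
  then have "?J = \<Union>?T" using UT XJ GJ by blast
  then have "comps ?J = maximal_elems ?T" using nested_Union_comps[OF nN TN] by simp
  moreover have "\<not> X \<subseteq> Y" if "Y \<in> R" "Y \<subset> P" for Y
    using that mX mG by (auto simp: under_def)
  then have "X \<in> maximal_elems ?T" by (simp add: maximal_elems_iff)
  ultimately have "X \<in> comps ?J" by simp
  then show ?thesis using X(1,2) mX below by (intro bexI[of _ X] conjI ballI impI)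
qed

text \<open>Let \<open>R\<close> be the common part and \<open>P\<close> the least member of \<open>R\<close> above some member of \<open>N\<close> outside
  \<open>N'\<close>. By \<open>least_element_component\<close>, the members of \<open>N\<close> and of \<open>N'\<close> that own the minimum of the
  block of \<open>P\<close> agree, hence lie in \<open>R\<close> and equal \<open>P\<close>. Then \<open>N\<close> has nothing new below \<open>P\<close>, a
  contradiction.\<close>

lemma ascending_unique:
  assumes N: "N \<in> maximal_nested_sets L B" and N': "N' \<in> maximal_nested_sets L B"
    and asc: "\<And>X. X \<in> N - N' \<Longrightarrow> ascent N X" and asc': "\<And>X. X \<in> N' - N \<Longrightarrow> ascent N' X"
  shows "N = N'"
proof (rule ccontr)
  assume ne: "N \<noteq> N'"
  have nN: "nested_set L B N" and nN': "nested_set L B N'"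
    using N N' by (simp_all add: maximal_nested_iff)
  let ?R = "N \<inter> N'"
  have R: "nested_set L B ?R"
    using nN' by (intro nested_mono[OF nN]) (use nN in \<open>auto simp: nested_set_def\<close>)
  obtain X0 where X0: "X0 \<in> N" "X0 \<notin> N'" using ne N nN' by (auto simp: maximal_nested_iff)
  have X0B: "X0 \<in> B" using X0 nested_subset_B[OF nN] by blast
  obtain M where M: "M \<in> maximal_elems B" "X0 \<subseteq> M" using ex_max_above[OF X0B] by blast
  have "M \<in> ?R" using M(1) R by (auto simp: nested_set_def)
  then obtain P where P: "P \<in> ?R" "X0 \<subseteq> P" "\<forall>Y\<in>?R. X0 \<subseteq> Y \<longrightarrow> P \<subseteq> Y"
    using nested_least_above[OF R B_nonempty[OF X0B] _ M(2)] by blast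
  let ?G = "under ?R P"
  define m where "m = Min (own ?R P)"
  let ?J = "cl (insert m ?G)"
  have m: "m \<in> own ?R P" unfolding m_def using Min_own_in[OF R P(1)] .
  obtain X where X: "X \<in> N" "X \<subseteq> P" "m \<in> X" "X \<in> comps ?J" "\<forall>Y\<in>N. Y \<subset> X \<longrightarrow> Y \<subseteq> ?G"
    unfolding m_def using least_element_component[OF N R _ P(1)] asc by blast
  obtain X' where X': "X' \<in> N'" "m \<in> X'" "X' \<in> comps ?J"
    unfolding m_def using least_element_component[OF N' R _ P(1)] asc' by blast
  have PB: "P \<in> B" using P nested_subset_B[OF R] by blast
  have "insert m ?G \<subseteq> E"
    using own_memD[OF m] under_subset[of ?R P] B_subset_ground[OF PB] by blast
  then have "X = X'" using comps_disjoint[OF cl_flat X(4) X'(3)] X(3) X'(2) by blast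
  then have XR: "X \<in> ?R" using X(1) X'(1) by blast
  have "X = P"
  proof (rule ccontr)
    assume "X \<noteq> P"
    then have "m \<in> ?G" using XR X(2,3) by (auto simp: under_def)
    then show False using m by (simp add: own_def)
  qed
  then have "X0 \<subset> X" using X0 P by blast
  then have X0G: "X0 \<subseteq> ?G" using X(5) X0 by blast
  obtain j where j: "j \<in> own N X0" using own_nonempty[OF nN X0(1)] by blast
  then have "j \<in> ?G" using X0G own_memD by blast
  then obtain C where C: "C \<in> ?R" "C \<subset> P" "j \<in> C" by (auto simp: under_def)
  then have "X0 \<subseteq> C" using own_member_iff[OF nN X0(1) j] by blast
  then show False using P(3) C by blast
qed

lemma vert_in_locus: "nested_set L B N \<Longrightarrow> vert N \<in> vertex_locus E B \<phi> N"
  using cubical_fun by (auto simp: cubical_def vertex_def)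

lemma vert_coefficients:
  assumes N: "nested_set L B N"
  shows "\<exists>a. (\<forall>Y\<in>N - maximal_elems B. a Y > 0) \<and> (\<forall>i. vert N $ i = sum a {Y \<in> N. i \<in> Y})"
proof -
  have "vert N \<in> rel_interior (nested_cone B N)"
    using vert_in_locus[OF N] by (simp add: vertex_locus_def)
  then obtain a where a: "\<forall>Y\<in>N - maximal_elems B. a Y > 0"
      "vert N = (\<Sum>Y\<in>N. a Y *\<^sub>R e_vec Y)"
    using rel_interior_nested_cone_coefficients[of B N "vert N"] N by (auto simp: nested_set_def)
  then have "\<forall>i. vert N $ i = sum a {Y \<in> N. i \<in> Y}" by (simp only: sum_e_vec_component) simp
  with a(1) show ?thesis by (intro exI[of _ a] conjI)
qed

lemma vert_sum:
  assumes N: "nested_set L B N" and Y: "Y \<in> N"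
  shows "sum (($) (vert N)) Y = \<phi> (e_vec Y)"
  using vert_in_locus[OF N] Y
  by (auto simp: vertex_locus_def hyperplane_of_def inner_e_vec[symmetric])

text \<open>The vertices of \<open>N\<close> and of \<open>N - {X}\<close> lie on the same hyperplanes for all members other than
  \<open>X\<close>, and the vertex of \<open>N\<close> has a positive coefficient at \<open>X\<close>. So their difference is governed by
  \<open>edge_direction\<close>.\<close>

lemma vert_edge:
  assumes N: "nested_set L B N" and X: "X \<in> N" and p: "parent N X P"
  shows "i \<in> own N X \<Longrightarrow> vert N $ i > vert (N - {X}) $ i"
    and "i \<in> own N P \<Longrightarrow> vert N $ i < vert (N - {X}) $ i"
    and "i \<notin> own N X \<Longrightarrow> i \<notin> own N P \<Longrightarrow> vert N $ i = vert (N - {X}) $ i"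
proof -
  let ?R = "N - {X}"
  have R: "nested_set L B ?R" using nested_remove[OF N p] .
  obtain a where a: "\<And>Y. Y \<in> N - maximal_elems B \<Longrightarrow> a Y > 0"
      "\<And>i. vert N $ i = sum a {Y \<in> N. i \<in> Y}"
    using vert_coefficients[OF N] by blast
  obtain b where b: "\<And>i. vert ?R $ i = sum b {Y \<in> ?R. i \<in> Y}"
    using vert_coefficients[OF R] by blast
  define c where "c Y = a Y - (if Y = X then 0 else b Y)" for Y
  define d where "d i = vert N $ i - vert ?R $ i" for i
  have fin: "finite N" using nested_finite[OF N] .
  have c: "c X > 0" using a(1) X parent_not_max[OF N p] by (simp add: c_def)
  have d: "d i = sum c {Y \<in> N. i \<in> Y}" for i
  proof -
    have "sum b {Y \<in> ?R. i \<in> Y} = sum (\<lambda>Y. if Y = X then 0 else b Y) {Y \<in> N. i \<in> Y}"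
      using fin by (intro sum.mono_neutral_cong_left) auto
    then show ?thesis by (simp add: d_def a(2) b c_def sum_subtractf)
  qed
  have orth: "sum d Y = 0" if Y: "Y \<in> N - {X}" for Y
    using vert_sum[OF N, of Y] vert_sum[OF R Y] Y by (simp add: d_def sum_subtractf)
  note e = edge_direction[OF N X p c d orth, of i]
  show "i \<in> own N X \<Longrightarrow> vert N $ i > vert ?R $ i" using e(1) by (simp add: d_def)
  show "i \<in> own N P \<Longrightarrow> vert N $ i < vert ?R $ i" using e(2) by (simp add: d_def)
  show "i \<notin> own N X \<Longrightarrow> i \<notin> own N P \<Longrightarrow> vert N $ i = vert ?R $ i"
    using e(3) by (simp add: d_def)
qed

lemma lex_trans:
  assumes "lex_precedes E u v" "lex_precedes E v w"
  shows "lex_precedes E u w"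
proof -
  obtain k l where k: "k \<in> E" "u $ k > v $ k" "\<forall>i\<in>E. i < k \<longrightarrow> u $ i = v $ i"
    and l: "l \<in> E" "v $ l > w $ l" "\<forall>i\<in>E. i < l \<longrightarrow> v $ i = w $ i"
    using assms by (auto simp: lex_precedes_def)
  consider "k < l" | "k = l" | "l < k" by fastforce
  then show ?thesis
  proof cases
    case 1
    then show ?thesis using k l by (auto simp: lex_precedes_def intro!: bexI[of _ k])
  next
    case 2
    then show ?thesis using k l by (auto simp: lex_precedes_def intro!: bexI[of _ k])
  next
    case 3
    then show ?thesis using k l by (auto simp: lex_precedes_def intro!: bexI[of _ l])
  qed
qed

lemma lex_irrefl: "\<not> lex_precedes E v v"
  by (simp add: lex_precedes_def)

lemma lex_total:
  assumes "k \<in> E" "v $ k \<noteq> w $ k"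
  shows "lex_precedes E v w \<or> lex_precedes E w v"
proof -
  let ?D = "{i \<in> E. v $ i \<noteq> w $ i}"
  have "?D \<noteq> {}" using assms by blast
  then have m: "Min ?D \<in> ?D" by (intro Min_in) simp_all
  have "v $ i = w $ i" if "i \<in> E" "i < Min ?D" for i
    using that Min_le[of ?D i] by (metis (mono_tags, lifting) finite leD mem_Collect_eq)
  then show ?thesis
    using m unfolding lex_precedes_def by (metis (mono_tags, lifting) linorder_neqE mem_Collect_eq)
qed

lemma ascent_lex_increases:
  assumes N: "nested_set L B N" and X: "X \<in> N" and p: "parent N X P"
  shows "Min (own N X) < Min (own N P) \<Longrightarrow> lex_precedes E (vert N) (vert (N - {X}))"
    and "Min (own N P) < Min (own N X) \<Longrightarrow> lex_precedes E (vert (N - {X})) (vert N)"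
proof -
  have P: "P \<in> N" using p by (simp add: parent_def)
  have inE: "own N Y \<subseteq> E" if "Y \<in> N" for Y
    using that own_subset nested_subset_B[OF N] B_subset_ground by blast
  have low: "i \<notin> own N Y" if "i < Min (own N Y)" for i Y using that by (meson Min_le finite leD)
  show "lex_precedes E (vert N) (vert (N - {X}))" if less: "Min (own N X) < Min (own N P)"
    unfolding lex_precedes_def
  proof (intro bexI[of _ "Min (own N X)"] conjI ballI impI)
    show "vert (N - {X}) $ Min (own N X) < vert N $ Min (own N X)"
      using vert_edge(1)[OF assms] Min_own_in[OF N X] by blast
    show "Min (own N X) \<in> E" using Min_own_in[OF N X] inE[OF X] by blast
    fix i assume "i < Min (own N X)"
    then show "vert N $ i = vert (N - {X}) $ i"
      using less by (intro vert_edge(3)[OF assms] low) auto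
  qed
  show "lex_precedes E (vert (N - {X})) (vert N)" if less: "Min (own N P) < Min (own N X)"
    unfolding lex_precedes_def
  proof (intro bexI[of _ "Min (own N P)"] conjI ballI impI)
    show "vert N $ Min (own N P) < vert (N - {X}) $ Min (own N P)"
      using vert_edge(2)[OF assms] Min_own_in[OF N P] by blast
    show "Min (own N P) \<in> E" using Min_own_in[OF N P] inE[OF P] by blast
    fix i assume "i < Min (own N P)"
    then show "vert (N - {X}) $ i = vert N $ i"
      using less by (intro vert_edge(3)[OF assms, symmetric] low) auto
  qed
qed

text \<open>At a descent the lexicographic order improves on the way from the vertex of \<open>N\<close> to that of
  the face \<open>N - {X}\<close>. It improves again on the way to the vertex of the exchanged nested set if
  the exchange moves the smallest index of the merged block to the new member.\<close>

lemma descent_improves: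
  assumes N: "N \<in> maximal_nested_sets L B" and X: "X \<in> N" and des: "\<not> ascent N X"
  shows "\<exists>X'. X' \<notin> N \<and> insert X' (N - {X}) \<in> maximal_nested_sets L B \<and>
    lex_precedes E (vert (insert X' (N - {X}))) (vert N)"
proof -
  let ?R = "N - {X}"
  have nN: "nested_set L B N" using N by (simp add: maximal_nested_iff)
  obtain P where p: "parent N X P" and le: "Min (own N P) \<le> Min (own N X)"
    using des by (auto simp: ascent_def)
  have P: "P \<in> N" "X \<subset> P" using p by (auto simp: parent_def)
  define m where "m = Min (own N P)"
  have m: "m \<in> own N P" unfolding m_def using Min_own_in[OF nN P(1)] .
  have "m \<noteq> Min (own N X)" using own_disjoint[OF nN P(1) m X] Min_own_in[OF nN X] P(2) by auto
  then have "m < Min (own N X)" using le by (simp add: m_def)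
  then have step1: "lex_precedes E (vert ?R) (vert N)"
    using ascent_lex_increases(2)[OF nN X p] by (simp add: m_def)
  obtain X' where X': "X' \<notin> N" "insert X' ?R \<in> maximal_nested_sets L B"
    "parent (insert X' ?R) X' P" "m \<in> own (insert X' ?R) X'"
    "own (insert X' ?R) P \<union> own (insert X' ?R) X' = own N P \<union> own N X"
    using nested_exchange[OF N X p m] by blast
  let ?N = "insert X' ?R"
  have nN': "nested_set L B ?N" using X'(2) by (simp add: maximal_nested_iff)
  have PN': "P \<in> ?N" "X' \<subset> P" using X'(3) by (auto simp: parent_def)
  have k: "Min (own ?N P) \<in> own ?N P" using Min_own_in[OF nN' PN'(1)] .
  then have "Min (own ?N P) \<in> own N P \<union> own N X" using X'(5) by blast
  moreover have "m \<le> i" if "i \<in> own N P \<union> own N X" for i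
    using that \<open>m < Min (own N X)\<close> by (auto simp: m_def intro: order_trans[OF less_imp_le])
  ultimately have "m \<le> Min (own ?N P)" by blast
  moreover have "m \<noteq> Min (own ?N P)"
    using own_disjoint[OF nN' PN'(1) k, of X'] X'(4) PN'(2) by auto
  moreover have "Min (own ?N X') \<le> m" using X'(4) by simp
  ultimately have "Min (own ?N X') < Min (own ?N P)" by order
  then have "lex_precedes E (vert ?N) (vert (?N - {X'}))"
    using ascent_lex_increases(1)[OF nN' _ X'(3)] by simp
  moreover have "?N - {X'} = ?R" using X'(1) by blast
  ultimately have "lex_precedes E (vert ?N) (vert ?R)" by simp
  then have "lex_precedes E (vert ?N) (vert N)" by (rule lex_trans[OF _ step1])
  then show ?thesis using X'(1,2) by blast
qed

lemma vert_inj: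
  assumes N: "N \<in> maximal_nested_sets L B" and N': "N' \<in> maximal_nested_sets L B"
    and eq: "vert N = vert N'"
  shows "N = N'"
proof -
  have nN: "nested_set L B N" and nN': "nested_set L B N'"
    using N N' by (simp_all add: maximal_nested_iff)
  obtain a where a: "\<And>Y. Y \<in> N - maximal_elems B \<Longrightarrow> a Y > 0"
      "\<And>i. vert N $ i = sum a {Y \<in> N. i \<in> Y}"
    using vert_coefficients[OF nN] by blast
  obtain a' where a': "\<And>Y. Y \<in> N' - maximal_elems B \<Longrightarrow> a' Y > 0"
      "\<And>i. vert N' $ i = sum a' {Y \<in> N'. i \<in> Y}"
    using vert_coefficients[OF nN'] by blast
  have "N \<subseteq> N'"
    using interior_determines_nested_set[OF nN a nN' a'(1)] a'(2) eq by simp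
  then show ?thesis using N nN' by (simp add: maximal_nested_iff)
qed

lemma vert_lex_total:
  assumes N: "N \<in> maximal_nested_sets L B" and N': "N' \<in> maximal_nested_sets L B"
    and ne: "N \<noteq> N'"
  shows "lex_precedes E (vert N) (vert N') \<or> lex_precedes E (vert N') (vert N)"
proof -
  obtain k where k: "vert N $ k \<noteq> vert N' $ k"
    using vert_inj[OF N N'] ne by (auto simp: vec_eq_iff)
  have zero: "vert Q $ i = 0" if Q: "Q \<in> maximal_nested_sets L B" and i: "i \<notin> E" for Q i
  proof -
    have nQ: "nested_set L B Q" using Q by (simp add: maximal_nested_iff)
    have none: "{Y \<in> Q. i \<in> Y} = {}" using i nested_subset_B[OF nQ] B_subset_ground by blast
    obtain a where "vert Q $ i = sum a {Y \<in> Q. i \<in> Y}" using vert_coefficients[OF nQ] by blast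
    then show ?thesis unfolding none by simp
  qed
  then have "k \<in> E" using k N N' by metis
  then show ?thesis using lex_total k by blast
qed

lemma ex_lex_first:
  assumes "A \<noteq> {}"
  shows "\<exists>N\<in>A. \<forall>N'\<in>A. \<not> lex_precedes E (vert N') (vert N)"
proof -
  let ?r = "\<lambda>N N'. lex_precedes E (vert N) (vert N')"
  have "asymp_on A ?r" using lex_trans lex_irrefl by (intro asymp_onI) blast
  moreover have "transp_on A ?r" using lex_trans by (intro transp_onI) blast
  ultimately have "\<exists>N\<in>A. \<forall>N'\<in>A. N' \<noteq> N \<longrightarrow> \<not> ?r N' N"
    using Finite_Set.bex_min_element[OF finite _ _ assms] by blast
  then show ?thesis using lex_irrefl by metis
qed

text \<open>Exchanges preserve cardinality. So the lexicographically first among the maximal nested sets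
  with a given cardinality has ascents only, and there is just one such set.\<close>

lemma maximal_nested_card_eq:
  assumes N: "N \<in> maximal_nested_sets L B" and N': "N' \<in> maximal_nested_sets L B"
  shows "card N = card N'"
proof -
  have "\<exists>Q\<in>maximal_nested_sets L B. card Q = card N \<and> (\<forall>X\<in>Q. ascent Q X)"
    if N: "N \<in> maximal_nested_sets L B" for N
  proof -
    let ?A = "{Q \<in> maximal_nested_sets L B. card Q = card N}"
    obtain Q where Q: "Q \<in> ?A" "\<forall>N'\<in>?A. \<not> lex_precedes E (vert N') (vert Q)"
      using ex_lex_first[of ?A] N by auto
    have "ascent Q X" if X: "X \<in> Q" for X
    proof (rule ccontr)
      assume "\<not> ascent Q X"
      then obtain X' where X': "X' \<notin> Q" "insert X' (Q - {X}) \<in> maximal_nested_sets L B"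
        "lex_precedes E (vert (insert X' (Q - {X}))) (vert Q)"
        using descent_improves[of Q X] Q(1) X by blast
      have "card (insert X' (Q - {X})) = card Q"
      proof -
        have "card (insert X' (Q - {X})) = Suc (card (Q - {X}))"
          using X'(1) by (intro card_insert_disjoint) auto
        also have "\<dots> = card Q" using X by (intro card_Suc_Diff1) auto
        finally show ?thesis .
      qed
      then show False using X' Q by auto
    qed
    then show ?thesis using Q(1) by auto
  qed
  then obtain Q Q' where "Q \<in> maximal_nested_sets L B" "card Q = card N" "\<forall>X\<in>Q. ascent Q X"
    "Q' \<in> maximal_nested_sets L B" "card Q' = card N'" "\<forall>X\<in>Q'. ascent Q' X"
    using N N' by metis
  moreover from this have "Q = Q'" by (intro ascending_unique) auto
  ultimately show ?thesis by simp
qed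

text \<open>Among the maximal nested sets through the common face of \<open>N\<close> and \<open>N'\<close>, the first one has
  no descents outside that face, as exchanging at a descent would stay in the star of the face.
  If \<open>N\<close> had no descents there either, it would be the first one by uniqueness, although \<open>N'\<close>
  precedes it.\<close>

lemma ex_descent:
  assumes N: "N \<in> maximal_nested_sets L B" and N': "N' \<in> maximal_nested_sets L B"
    and less: "lex_precedes E (vert N') (vert N)"
  shows "\<exists>X\<in>N - N'. \<not> ascent N X"
proof (rule ccontr)
  assume "\<not> ?thesis"
  then have asc: "\<And>X. X \<in> N - N' \<Longrightarrow> ascent N X" by blast
  let ?A = "{Q \<in> maximal_nested_sets L B. N \<inter> N' \<subseteq> Q}"
  obtain Q where Q: "Q \<in> ?A" "\<forall>Q'\<in>?A. \<not> lex_precedes E (vert Q') (vert Q)"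
    using ex_lex_first[of ?A] N by auto
  have "ascent Q X" if X: "X \<in> Q - N" for X
  proof (rule ccontr)
    assume "\<not> ascent Q X"
    then obtain X' where "insert X' (Q - {X}) \<in> maximal_nested_sets L B"
      "lex_precedes E (vert (insert X' (Q - {X}))) (vert Q)"
      using descent_improves[of Q X] Q(1) X by blast
    moreover have "N \<inter> N' \<subseteq> insert X' (Q - {X})" using Q(1) X by blast
    ultimately show False using Q(2) by blast
  qed
  moreover have "ascent N X" if "X \<in> N - Q" for X using asc that Q(1) by blast
  ultimately have "N = Q" using ascending_unique[OF N, of Q] Q(1) by blast
  then show False using Q(2) N' less by blast
qed

lemma complex_pure: "pure_complex (nested_set_complex L B)"
proof -
  let ?M = "maximal_elems B"
  have "G \<in> nested_set_complex L B" if F: "F \<in> nested_set_complex L B" and GF: "G \<subseteq> F" for F G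
  proof -
    obtain N where N: "nested_set L B N" "F = N - ?M"
      using F unfolding nested_set_complex_def by blast
    have "nested_set L B (G \<union> ?M)"
      using N GF by (intro nested_mono[OF N(1)]) (auto simp: nested_set_def)
    moreover have "G = (G \<union> ?M) - ?M" using GF N(2) by blast
    ultimately show ?thesis unfolding nested_set_complex_def by blast
  qed
  then have "simplicial_complex (nested_set_complex L B)" by (auto simp: simplicial_complex_def)
  moreover have "card F = card G"
    if FG: "F \<in> facets (nested_set_complex L B)" "G \<in> facets (nested_set_complex L B)" for F G
  proof -
    obtain N N' where N: "N \<in> maximal_nested_sets L B" "F = N - ?M"
      and N': "N' \<in> maximal_nested_sets L B" "G = N' - ?M"
      using FG unfolding facets_nested_set_complex by blast
    have "?M \<subseteq> N" "?M \<subseteq> N'" using N N' by (auto simp: maximal_nested_iff nested_set_def)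
    then show ?thesis using N N' maximal_nested_card_eq[OF N(1) N'(1)] by (simp add: card_Diff_subset)
  qed
  ultimately show ?thesis unfolding pure_complex_def by blast
qed

lemma maximal_nested_eq_iff:
  assumes "N \<in> maximal_nested_sets L B" "N' \<in> maximal_nested_sets L B"
  shows "N - maximal_elems B = N' - maximal_elems B \<longleftrightarrow> N = N'"
proof -
  have "maximal_elems B \<subseteq> N" "maximal_elems B \<subseteq> N'"
    using assms by (simp_all add: maximal_nested_iff nested_set_def)
  then show ?thesis by blast
qed

lemma facet_lex_order_iff:
  assumes "N \<in> maximal_nested_sets L B" "N' \<in> maximal_nested_sets L B"
  shows "(N - maximal_elems B, N' - maximal_elems B) \<in> facet_lex_order E L B \<phi> \<longleftrightarrow>
    lex_precedes E (vert N) (vert N')"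
proof
  assume "(N - maximal_elems B, N' - maximal_elems B) \<in> facet_lex_order E L B \<phi>"
  then obtain Q Q' where Q: "Q \<in> maximal_nested_sets L B" "Q' \<in> maximal_nested_sets L B"
    and eq: "N - maximal_elems B = Q - maximal_elems B" "N' - maximal_elems B = Q' - maximal_elems B"
    and lex: "lex_precedes E (vert Q) (vert Q')"
    unfolding facet_lex_order_def by blast
  have "N = Q" "N' = Q'" using maximal_nested_eq_iff assms Q eq by metis+
  then show "lex_precedes E (vert N) (vert N')" using lex by simp
next
  assume "lex_precedes E (vert N) (vert N')"
  then show "(N - maximal_elems B, N' - maximal_elems B) \<in> facet_lex_order E L B \<phi>"
    unfolding facet_lex_order_def using assms by blast
qed

lemma facet_lex_order_linear:
  "strict_linear_order_on (facets (nested_set_complex L B)) (facet_lex_order E L B \<phi>)"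
  unfolding strict_linear_order_on_def
proof (intro conjI)
  show "trans (facet_lex_order E L B \<phi>)"
  proof (rule transI)
    fix F G H assume FG: "(F, G) \<in> facet_lex_order E L B \<phi>" and GH: "(G, H) \<in> facet_lex_order E L B \<phi>"
    then obtain N1 N2 N3 where N1: "N1 \<in> maximal_nested_sets L B" "F = N1 - maximal_elems B"
      and N2: "N2 \<in> maximal_nested_sets L B" "G = N2 - maximal_elems B"
      and N3: "N3 \<in> maximal_nested_sets L B" "H = N3 - maximal_elems B"
      unfolding facet_lex_order_def by blast
    have "lex_precedes E (vert N1) (vert N2)" "lex_precedes E (vert N2) (vert N3)"
      using FG GH facet_lex_order_iff N1 N2 N3 by blast+
    then have "lex_precedes E (vert N1) (vert N3)" by (rule lex_trans)
    then show "(F, H) \<in> facet_lex_order E L B \<phi>" using facet_lex_order_iff N1 N3 by blast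
  qed
  show "irrefl (facet_lex_order E L B \<phi>)"
  proof (rule irreflI)
    fix F show "(F, F) \<notin> facet_lex_order E L B \<phi>"
    proof
      assume F: "(F, F) \<in> facet_lex_order E L B \<phi>"
      then obtain N where "N \<in> maximal_nested_sets L B" "F = N - maximal_elems B"
        unfolding facet_lex_order_def by blast
      then show False using F lex_irrefl by (simp add: facet_lex_order_iff)
    qed
  qed
  show "total_on (facets (nested_set_complex L B)) (facet_lex_order E L B \<phi>)"
    unfolding facets_nested_set_complex
    by (rule total_onI) (auto simp: facet_lex_order_iff dest: vert_lex_total)
qed

lemma facet_lex_order_shelling:
  "shelling_order (nested_set_complex L B) (facet_lex_order E L B \<phi>)"
  unfolding shelling_order_def
proof (intro conjI ballI impI complex_pure facet_lex_order_linear)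
  let ?M = "maximal_elems B" and ?r = "facet_lex_order E L B \<phi>"
  show "?r \<subseteq> facets (nested_set_complex L B) \<times> facets (nested_set_complex L B)"
    unfolding facets_nested_set_complex facet_lex_order_def by blast
  fix F F'
  assume "F \<in> facets (nested_set_complex L B)" "F' \<in> facets (nested_set_complex L B)"
    and FF': "(F', F) \<in> ?r"
  then obtain N N' where N: "N \<in> maximal_nested_sets L B" "F = N - ?M"
    and N': "N' \<in> maximal_nested_sets L B" "F' = N' - ?M"
    unfolding facets_nested_set_complex by blast
  have "lex_precedes E (vert N') (vert N)" using FF' N N' facet_lex_order_iff by simp
  then obtain X where X: "X \<in> N" "X \<notin> N'" "\<not> ascent N X" using ex_descent[OF N(1) N'(1)] by blast
  then obtain X' where X': "X' \<notin> N" "insert X' (N - {X}) \<in> maximal_nested_sets L B"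
    "lex_precedes E (vert (insert X' (N - {X}))) (vert N)"
    using descent_improves[OF N(1)] by blast
  have MN: "?M \<subseteq> N" "?M \<subseteq> N'"
    using N N' by (auto simp: maximal_nested_iff nested_set_def)
  let ?F = "insert X' (N - {X}) - ?M"
  have "?F \<in> facets (nested_set_complex L B)" using X'(2) unfolding facets_nested_set_complex by blast
  moreover have "X \<in> F" using X N(2) MN(2) by blast
  moreover have "(?F, F) \<in> ?r" using X' N facet_lex_order_iff by simp
  moreover have "F \<inter> F' \<subseteq> F \<inter> ?F" using N(2) N'(2) X by blast
  moreover have "F \<inter> ?F = F - {X}" using N(2) X'(1) by blast
  ultimately show "\<exists>F''\<in>facets (nested_set_complex L B). \<exists>X\<in>F.
      (F'', F) \<in> ?r \<and> F \<inter> F' \<subseteq> F \<inter> F'' \<and> F \<inter> F'' = F - {X}" by blast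
qed

end

theorem theorem1:
  fixes E :: "'e::{finite,linorder} set"
    and indep :: "'e set \<Rightarrow> bool"
    and B :: "'e set set"
    and \<phi> :: "(real, 'e) vec \<Rightarrow> real"
  assumes "matroid E indep"
    and "loopless E indep"
    and "building_set (flats E indep) B"
    and "cubical E (flats E indep) B \<phi>"
  shows "shelling_order (nested_set_complex (flats E indep) B)
           (facet_lex_order E (flats E indep) B \<phi>)"
proof -
  interpret cubical_matroid E indep B \<phi>
    using assms
    by (intro cubical_matroid.intro built_matroid.intro built_matroid_axioms.intro
        cubical_matroid_axioms.intro)
  show ?thesis by (rule facet_lex_order_shelling)
qed

end
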